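(* Let $(Q_j)_{j=1}^\infty$ be a sequence of basic sequences, each of which is infinite in limit. Suppose that at least one of the following conditions holds: (1) for every $j$, $Q_j$ is $1$-convergent; (2) $Q_1$ is $1$-divergent and there exists a basic sequence $S=(s_n)$ such that $Q_j\sim_{s_j}Q_{j+1}$ for every $j\ge1$. Then $$\dim_{\mathrm H}\left(\bigcap_{j=1}^\infty \mathscr{DN}(Q_j)\setminus\mathscr{RN}(Q_j)\right)=\dim_{\mathrm H}\left(\bigcap_{j=1}^\infty \mathscr{DN}(Q_j)\setminus\mathscr{N}(Q_j)\right)=1.$$ Additionally, for any basic sequence $Q$ that is infinite in limit, $$\dim_{\mathrm H}\left(\mathscr{DN}(Q)\setminus\mathscr{RN}(Q)\right)=\dim_{\mathrm H}\left(\mathscr{DN}(Q)\setminus\mathscr{N}(Q)\right)=1.$$ Here $\dim_{\mathrm H}$ denotes Hausdorff dimension.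
   Context: A basic sequence is a sequence $Q=(q_n)_{n=1}^\infty$ of integers $q_n\ge 2$. It is infinite in limit if $q_n\to\infty$. It is $1$-divergent if $\sum_{n=1}^\infty 1/q_n=\infty$, and $1$-convergent otherwise. The $Q$-Cantor series expansion of $x\in\mathbb R$ is the unique expansion $x=\lfloor x\rfloor+\sum_{n=1}^\infty \frac{E_n}{q_1q_2\cdots q_n}$ with $E_n\in\{0,1,\dots,q_n-1\}$ for $n\ge1$ and $E_n\ne q_n-1$ for infinitely many $n$. For a block (finite sequence) $B$ of non-negative integers, $N_n^Q(B,x)$ is the number of times $B$ occurs in the digit sequence $(E_1,E_2,\dots)$ of $x$ starting at a position no greater than $n$. Put $Q_n^{(k)}=\sum_{j=1}^n \frac{1}{q_jq_{j+1}\cdots q_{j+k-1}}$. $\mathscr{N}_k(Q)$ is the set of real $x$ with $\lim_{n\to\infty}N_n^Q(B,x)/Q_n^{(k)}=1$ for all blocks $B$ of length $k$, and $\mathscr N(Q)=\bigcap_{k\ge1}\mathscr N_k(Q)$. $\mathscr{RN}_k(Q)$ is the set of real $x$ such that for all blocks $B_1,B_2$ of length $k$, $\lim_{n\to\infty} N_n^Q(B_1,x)/N_n^Q(B_2,x)=1$, and $\mathscr{RN}(Q)=\bigcap_{k\ge1}\mathscr{RN}_k(Q)$. $T_{Q,n}(x)=\left(\prod_{j=1}^n q_j\right)x \pmod 1$, and $\mathscr{DN}(Q)$ is the set of real $x$ such that $(T_{Q,n}(x))_{n=0}^\infty$ is uniformly distributed mod $1$. For basic sequences $P=(p_n)$,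 $Q=(q_n)$ and a positive integer $s$, we write $P\sim_s Q$ if $q_n=\prod_{j=1}^s p_{s(n-1)+j}$ for all $n\ge 1$. *)

theory Defs
  imports "HOL-Analysis.Analysis"
begin

text \<open>
  All sequences are indexed from 1: a sequence \<open>(q\<^sub>n)\<close> is a function on \<^typ>\<open>nat\<close> whose value
  at 0 is never used.
\<close>

definition basic_sequence :: "(nat \<Rightarrow> nat) \<Rightarrow> bool" where
  "basic_sequence Q \<longleftrightarrow> (\<forall>n\<ge>1. Q n \<ge> 2)"

definition infinite_in_limit :: "(nat \<Rightarrow> nat) \<Rightarrow> bool" where
  "infinite_in_limit Q \<longleftrightarrow> filterlim Q at_top sequentially"

text \<open>The terms \<open>1 / q\<^sub>n\<close> are nonnegative, so the series diverges to infinity iff it is not summable.\<close>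

definition one_divergent :: "(nat \<Rightarrow> nat) \<Rightarrow> bool" where
  "one_divergent Q \<longleftrightarrow> \<not> summable (\<lambda>n. 1 / real (Q (Suc n)))"

definition one_convergent :: "(nat \<Rightarrow> nat) \<Rightarrow> bool" where
  "one_convergent Q \<longleftrightarrow> \<not> one_divergent Q"

text \<open>The condition \<open>E 0 = 0\<close> only pins down the unused value, so that the expansion is unique.\<close>

definition cantor_expansion :: "(nat \<Rightarrow> nat) \<Rightarrow> real \<Rightarrow> (nat \<Rightarrow> nat) \<Rightarrow> bool" where
  "cantor_expansion Q x E \<longleftrightarrow>
     E 0 = 0 \<and>
     (\<forall>n\<ge>1. E n \<in> {0..Q n - 1}) \<and>
     infinite {n. n \<ge> 1 \<and> E n \<noteq> Q n - 1} \<and>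
     (\<lambda>n. real (E (Suc n)) / (\<Prod>j=1..Suc n. real (Q j))) sums (x - of_int \<lfloor>x\<rfloor>)"

definition cantor_digits :: "(nat \<Rightarrow> nat) \<Rightarrow> real \<Rightarrow> nat \<Rightarrow> nat" where
  "cantor_digits Q x = (THE E. cantor_expansion Q x E)"

definition block_count :: "(nat \<Rightarrow> nat) \<Rightarrow> nat \<Rightarrow> nat list \<Rightarrow> real \<Rightarrow> nat" where
  "block_count Q n B x =
     card {i \<in> {1..n}. \<forall>m<length B. cantor_digits Q x (i + m) = B ! m}"

definition block_weight :: "(nat \<Rightarrow> nat) \<Rightarrow> nat \<Rightarrow> nat \<Rightarrow> real" where
  "block_weight Q k n = (\<Sum>j=1..n. 1 / (\<Prod>i=j..<j + k. real (Q i)))"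

definition normal_order :: "nat \<Rightarrow> (nat \<Rightarrow> nat) \<Rightarrow> real set" where
  "normal_order k Q =
     {x. \<forall>B. length B = k \<longrightarrow>
           (\<lambda>n. real (block_count Q n B x) / block_weight Q k n) \<longlonglongrightarrow> 1}"

definition normal_numbers :: "(nat \<Rightarrow> nat) \<Rightarrow> real set" where
  "normal_numbers Q = (\<Inter>k\<in>{1..}. normal_order k Q)"

text \<open>
  If \<open>B\<^sub>2\<close> never occurs, then all quotients below are \<open>0\<close> by the convention \<open>a / 0 = 0\<close> and the
  limit \<open>1\<close> is not attained; otherwise the denominators are eventually nonzero.
\<close>

definition ratio_normal_order :: "nat \<Rightarrow> (nat \<Rightarrow> nat) \<Rightarrow> real set" where
  "ratio_normal_order k Q =
     {x. \<forall>B\<^sub>1 B\<^sub>2. length B\<^sub>1 = k \<and> length B\<^sub>2 = k \<longrightarrow>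
           (\<lambda>n. real (block_count Q n B\<^sub>1 x) / real (block_count Q n B\<^sub>2 x)) \<longlonglongrightarrow> 1}"

definition ratio_normal_numbers :: "(nat \<Rightarrow> nat) \<Rightarrow> real set" where
  "ratio_normal_numbers Q = (\<Inter>k\<in>{1..}. ratio_normal_order k Q)"

definition cantor_shift :: "(nat \<Rightarrow> nat) \<Rightarrow> nat \<Rightarrow> real \<Rightarrow> real" where
  "cantor_shift Q n x = frac ((\<Prod>j=1..n. real (Q j)) * x)"

definition uniformly_distributed_mod1 :: "(nat \<Rightarrow> real) \<Rightarrow> bool" where
  "uniformly_distributed_mod1 u \<longleftrightarrow>
     (\<forall>a b. 0 \<le> a \<and> a < b \<and> b \<le> 1 \<longrightarrow>
        (\<lambda>N. real (card {n. n < N \<and> frac (u n) \<in> {a..<b}}) / real N) \<longlonglongrightarrow> b - a)"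

definition distribution_normal_numbers :: "(nat \<Rightarrow> nat) \<Rightarrow> real set" where
  "distribution_normal_numbers Q =
     {x. uniformly_distributed_mod1 (\<lambda>n. cantor_shift Q n x)}"

definition block_product_related :: "nat \<Rightarrow> (nat \<Rightarrow> nat) \<Rightarrow> (nat \<Rightarrow> nat) \<Rightarrow> bool" where
  "block_product_related s P Q \<longleftrightarrow> (\<forall>n\<ge>1. Q n = (\<Prod>j=1..s. P (s * (n - 1) + j)))"

text \<open>
  Hausdorff measure and dimension. Covering sets are required to be bounded because
  \<^const>\<open>diameter\<close> is meaningful only for bounded sets. Only exponents \<open>s > 0\<close> are used, so the
  value of \<open>0 powr 0\<close> plays no role.
\<close>

definition hausdorff_premeasure :: "real \<Rightarrow> real \<Rightarrow> 'a::metric_space set \<Rightarrow> ennreal" where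
  "hausdorff_premeasure s \<delta> A =
     (INF U \<in> {U :: nat \<Rightarrow> 'a set. A \<subseteq> (\<Union>i. U i) \<and> (\<forall>i. bounded (U i) \<and> diameter (U i) \<le> \<delta>)}.
        \<Sum>i. ennreal (diameter (U i) powr s))"

definition hausdorff_measure :: "real \<Rightarrow> 'a::metric_space set \<Rightarrow> ennreal" where
  "hausdorff_measure s A = (SUP \<delta>\<in>{0<..}. hausdorff_premeasure s \<delta> A)"

definition hausdorff_dim :: "'a::metric_space set \<Rightarrow> ereal" where
  "hausdorff_dim A = (INF s\<in>{s. s > 0 \<and> hausdorff_measure s A = 0}. ereal s)"


text \<open>Existence and uniqueness of the expansion, so that \<^const>\<open>cantor_digits\<close> is well defined.\<close>

lemma cantor_expansion_exists:
  assumes Q: "basic_sequence Q"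
  shows "\<exists>E. cantor_expansion Q x E"
proof -
  define P where "P n = (\<Prod>j=1..n. real (Q j))" for n
  define t where "t n = frac (P n * x)" for n
  define e where "e n = \<lfloor>real (Q (Suc n)) * t n\<rfloor>" for n
  define E where "E n = (case n of 0 \<Rightarrow> 0 | Suc m \<Rightarrow> nat (e m))" for n
  have Q2: "Q (Suc n) \<ge> 2" for n using Q by (auto simp: basic_sequence_def)
  have PS: "P (Suc n) = P n * real (Q (Suc n))" for n by (simp add: P_def)
  have P2: "P n \<ge> 2 ^ n" for n
  proof (induction n)
    case 0 then show ?case by (simp add: P_def)
  next
    case (Suc n)
    have "2 ^ n * 2 \<le> P n * real (Q (Suc n))"
      using Suc Q2[of n] by (intro mult_mono) (auto intro: order_trans[OF _ Suc])
    then show ?case by (simp add: PS mult.commute)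
  qed
  have Ppos: "P n > 0" for n using P2[of n] by (rule less_le_trans[rotated]) simp
  have t01: "0 \<le> t n" "t n < 1" for n by (auto simp: t_def frac_lt_1)
  have e0: "0 \<le> e n" for n using t01[of n] by (simp add: e_def)
  have elt: "e n < int (Q (Suc n))" for n
  proof -
    have "real (Q (Suc n)) * t n < real (Q (Suc n)) * 1"
      using t01[of n] Q2[of n] by (intro mult_strict_left_mono) auto
    then show ?thesis by (simp add: e_def floor_less_iff)
  qed
  have tS: "t (Suc n) = real (Q (Suc n)) * t n - of_int (e n)" for n
  proof -
    have "P (Suc n) * x = real (Q (Suc n)) * t n + of_int (int (Q (Suc n)) * \<lfloor>P n * x\<rfloor>)"
      by (simp add: PS t_def frac_def algebra_simps)
    then have "t (Suc n) = frac (real (Q (Suc n)) * t n + of_int (int (Q (Suc n)) * \<lfloor>P n * x\<rfloor>))"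
      by (simp only: t_def)
    also have "\<dots> = frac (real (Q (Suc n)) * t n)"
      unfolding frac_def by (simp only: floor_add_int[symmetric] of_int_add)
    also have "\<dots> = real (Q (Suc n)) * t n - of_int (e n)" by (simp add: frac_def e_def)
    finally show ?thesis .
  qed
  have ES: "real (E (Suc n)) = of_int (e n)" for n using e0[of n] by (simp add: E_def)
  have part: "(\<Sum>i<n. real (E (Suc i)) / P (Suc i)) = frac x - t n / P n" for n
  proof (induction n)
    case 0 then show ?case by (simp add: t_def P_def)
  next
    case (Suc n)
    have "t n / P n = of_int (e n) / P (Suc n) + t (Suc n) / P (Suc n)"
      using Ppos[of n] Q2[of n] unfolding tS PS by (simp add: field_simps)
    then show ?case using Suc by (simp add: ES)
  qed
  have "(\<lambda>n. t n / P n) \<longlonglongrightarrow> 0"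
  proof (rule tendsto_sandwich[OF _ _ tendsto_const])
    show "(\<lambda>n. (1/2::real) ^ n) \<longlonglongrightarrow> 0" by (rule LIMSEQ_realpow_zero) auto
    show "\<forall>\<^sub>F n in sequentially. 0 \<le> t n / P n"
      using t01 Ppos by (intro always_eventually allI divide_nonneg_pos) auto
    show "\<forall>\<^sub>F n in sequentially. t n / P n \<le> (1/2) ^ n"
    proof (intro always_eventually allI)
      fix n
      have "t n / P n \<le> 1 / 2 ^ n"
        using t01[of n] P2[of n] by (intro frac_le) auto
      then show "t n / P n \<le> (1/2) ^ n" by (simp add: power_divide)
    qed
  qed
  then have "(\<lambda>n. frac x - t n / P n) \<longlonglongrightarrow> frac x - 0"
    by (intro tendsto_diff tendsto_const)
  then have sums: "(\<lambda>n. real (E (Suc n)) / P (Suc n)) sums frac x"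
    unfolding sums_def part by simp
  have inf: "infinite {n. n \<ge> 1 \<and> E n \<noteq> Q n - 1}"
  proof
    assume "finite {n. n \<ge> 1 \<and> E n \<noteq> Q n - 1}"
    then obtain M where M: "\<And>n. n \<ge> 1 \<Longrightarrow> E n \<noteq> Q n - 1 \<Longrightarrow> n \<le> M"
      unfolding finite_nat_set_iff_bounded_le by auto
    have step: "1 - t (Suc n) = real (Q (Suc n)) * (1 - t n)" if "n \<ge> M" for n
    proof -
      have "E (Suc n) = Q (Suc n) - 1" using M[of "Suc n"] that by fastforce
      then have "of_int (e n) = real (Q (Suc n)) - 1" using ES[of n] Q2[of n] by (simp add: of_nat_diff)
      then show ?thesis by (simp add: tS algebra_simps)
    qed
    have "1 - t (M + k) \<ge> 2 ^ k * (1 - t M)" for k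
    proof (induction k)
      case (Suc k)
      have "2 * (2 ^ k * (1 - t M)) \<le> real (Q (Suc (M + k))) * (1 - t (M + k))"
        using Suc Q2[of "M + k"] t01[of "M"] by (intro mult_mono) auto
      then show ?case using step[of "M + k"] by simp
    qed simp
    then have bd: "2 ^ k * (1 - t M) \<le> 1" for k using t01(1)[of "M + k"]
      by (smt (verit))
    obtain k where "1 / (1 - t M) < 2 ^ k" using real_arch_pow[of 2 "1 / (1 - t M)"] by auto
    then show False using bd[of k] t01(2)[of M] by (simp add: field_simps)
  qed
  have "E n \<in> {0..Q n - 1}" if n1: "n \<ge> 1" for n
  proof -
    obtain m where m: "n = Suc m" using n1 by (cases n) auto
    then show ?thesis using elt[of m] e0[of m] by (simp add: E_def)
  qed
  then have "cantor_expansion Q x E"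
    using inf sums by (auto simp: cantor_expansion_def P_def frac_def E_def)
  then show ?thesis by blast
qed

lemma cantor_expansion_unique:
  assumes Q: "basic_sequence Q" and E: "cantor_expansion Q x E" and F: "cantor_expansion Q x F"
  shows "E = F"
proof -
  define P where "P n = (\<Prod>j=1..n. real (Q j))" for n
  have Q2: "Q (Suc n) \<ge> 2" for n using Q by (auto simp: basic_sequence_def)
  have PS: "P (Suc n) = P n * real (Q (Suc n))" for n by (simp add: P_def)
  have P2: "P n \<ge> 2 ^ n" for n
  proof (induction n)
    case 0 then show ?case by (simp add: P_def)
  next
    case (Suc n)
    have "2 ^ n * 2 \<le> P n * real (Q (Suc n))"
      using Suc Q2[of n] by (intro mult_mono) (auto intro: order_trans[OF _ Suc])
    then show ?case by (simp add: PS mult.commute)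
  qed
  have Ppos: "P n > 0" for n using P2[of n] by (rule less_le_trans[rotated]) simp
  have Pinv: "(\<lambda>n. 1 / P n) \<longlonglongrightarrow> 0"
  proof (rule tendsto_sandwich[OF _ _ tendsto_const])
    show "(\<lambda>n. (1/2::real) ^ n) \<longlonglongrightarrow> 0" by (rule LIMSEQ_realpow_zero) auto
    show "\<forall>\<^sub>F n in sequentially. 0 \<le> 1 / P n"
      using Ppos by (intro always_eventually allI divide_nonneg_pos) auto
    show "\<forall>\<^sub>F n in sequentially. 1 / P n \<le> (1/2) ^ n"
    proof (intro always_eventually allI)
      fix n
      have "1 / P n \<le> 1 / 2 ^ n" using P2[of n] by (intro frac_le) auto
      then show "1 / P n \<le> (1/2) ^ n" by (simp add: power_divide)
    qed
  qed
  define r where "r G n = P n * (frac x - (\<Sum>i<n. real (G (Suc i)) / P (Suc i)))"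
    for G :: "nat \<Rightarrow> nat" and n
  have rS: "r G (Suc n) = real (Q (Suc n)) * r G n - real (G (Suc n))" for G n
    using Ppos[of n] Q2[of n] by (simp add: r_def PS field_simps)
  have r01: "0 \<le> r G n \<and> r G n < 1" if G: "cantor_expansion Q x G" for G n
  proof -
    have dig: "G (Suc n) \<le> Q (Suc n) - 1" for n using G by (auto simp: cantor_expansion_def)
    have dig': "real (G (Suc n)) \<le> real (Q (Suc n)) - 1" for n
      using dig[of n] Q2[of n] by linarith
    have "(\<lambda>n. real (G (Suc n)) / P (Suc n)) sums frac x"
      using G by (simp add: cantor_expansion_def P_def frac_def)
    then have "(\<lambda>n. frac x - (\<Sum>i<n. real (G (Suc i)) / P (Suc i))) \<longlonglongrightarrow> frac x - frac x"
      unfolding sums_def by (intro tendsto_diff tendsto_const)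
    then have lim: "(\<lambda>n. r G n / P n) \<longlonglongrightarrow> 0"
      using Ppos by (simp add: r_def less_imp_neq[THEN not_sym])
    have "decseq (\<lambda>n. r G n / P n)"
    proof (rule decseq_SucI)
      fix n
      have "r G (Suc n) / P (Suc n) \<le> (real (Q (Suc n)) * r G n) / P (Suc n)"
        using Ppos[of "Suc n"] by (intro divide_right_mono) (auto simp: rS)
      then show "r G (Suc n) / P (Suc n) \<le> r G n / P n" using Q2[of n] by (simp add: PS)
    qed
    then have "0 \<le> r G n / P n" using lim by (rule decseq_ge)
    then have ge: "0 \<le> r G n" using Ppos[of n] by (simp add: zero_le_divide_iff)
    have "incseq (\<lambda>n. r G n / P n - 1 / P n)"
    proof (rule incseq_SucI)
      fix n
      have "(real (Q (Suc n)) * (r G n - 1)) / P (Suc n) \<le> (r G (Suc n) - 1) / P (Suc n)"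
        using Ppos[of "Suc n"] dig'[of n]
        by (intro divide_right_mono) (auto simp: rS algebra_simps)
      moreover have "(real (Q (Suc n)) * (r G n - 1)) / P (Suc n) = (r G n - 1) / P n"
        using Q2[of n] by (simp add: PS)
      ultimately show "r G n / P n - 1 / P n \<le> r G (Suc n) / P (Suc n) - 1 / P (Suc n)"
        by (simp add: diff_divide_distrib)
    qed
    moreover have "(\<lambda>n. r G n / P n - 1 / P n) \<longlonglongrightarrow> 0"
      using tendsto_diff[OF lim Pinv] by simp
    ultimately have le: "r G n \<le> 1" for n
      using incseq_le[of "\<lambda>n. r G n / P n - 1 / P n" 0 n] Ppos[of n] by (simp add: divide_le_cancel)
    have "r G n \<noteq> 1"
    proof
      assume one: "r G n = 1"
      have all1: "r G (n + k) = 1" for k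
      proof (induction k)
        case (Suc k)
        then show ?case using rS[of G "n + k"] dig'[of "n + k"] le[of "Suc (n + k)"] by simp
      qed (simp add: one)
      have "G m = Q m - 1" if mn: "m > n" for m
      proof -
        obtain k where "m = Suc (n + k)" using less_imp_Suc_add[OF mn] by auto
        then show ?thesis using rS[of G "n + k"] all1[of k] all1[of "Suc k"] by simp
      qed
      then have "{m. m \<ge> 1 \<and> G m \<noteq> Q m - 1} \<subseteq> {..n}" by (auto simp: not_le[symmetric])
      then have "finite {m. m \<ge> 1 \<and> G m \<noteq> Q m - 1}" by (rule finite_subset) simp
      then show False using G by (simp add: cantor_expansion_def)
    qed
    then show ?thesis using ge le[of n] by simp
  qed
  have dig: "int (G (Suc n)) = \<lfloor>real (Q (Suc n)) * r G n\<rfloor>" if "cantor_expansion Q x G" for G n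
    using r01[OF that, of "Suc n"] rS[of G n] by (intro floor_unique[symmetric]) auto
  have req: "r E n = r F n" for n
  proof (induction n)
    case 0 then show ?case by (simp add: r_def)
  next
    case (Suc n)
    then have "E (Suc n) = F (Suc n)" using dig[OF E, of n] dig[OF F, of n] by simp
    then show ?case using Suc by (simp add: rS)
  qed
  show ?thesis
  proof
    fix n
    show "E n = F n"
    proof (cases n)
      case 0 then show ?thesis using E F by (simp add: cantor_expansion_def)
    next
      case (Suc m) then show ?thesis using dig[OF E, of m] dig[OF F, of m] req[of m] by simp
    qed
  qed
qed

lemma cantor_expansion_cantor_digits:
  assumes "basic_sequence Q"
  shows "cantor_expansion Q x (cantor_digits Q x)"
  unfolding cantor_digits_def
  using cantor_expansion_exists[OF assms, of x] cantor_expansion_unique[OF assms]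
  by (metis theI)

end

theory Submission
  imports Defs "HOL-Probability.Probability"
begin

text \<open>
  A number that is normal or ratio normal contains every block \<open>[0, b]\<close>, so it has infinitely many
  zero digits. It therefore suffices to find distribution normal numbers with finitely many zeros.

  Choose the digits at random and independently, the \<open>n\<close>-th one uniformly from \<open>{d..<q\<^sub>n}\<close> with
  \<open>d \<in> {0, 1}\<close>. Since \<open>q\<^sub>n \<rightarrow> \<infinity>\<close>, Hoeffding's inequality and the Borel--Cantelli lemma show that almost
  surely the shifts along every arithmetic progression \<open>0, t, 2 t, \<dots>\<close> are uniformly distributed.
  For \<open>d = 1\<close> no zeros occur, the same holds for the digits with respect to all iterated block
  products of \<open>Q\<close>, and intervals of length \<open>r\<close> have mass \<open>O(r\<^sup>s)\<close> for every \<open>s < 1\<close>, so the mass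
  distribution principle gives dimension 1. For \<open>d = 0\<close> the random number is Lebesgue distributed, and
  1-convergence makes the number of zeros almost surely finite; countably many unrelated basic
  sequences are then treated simultaneously.
\<close>

section \<open>Hausdorff dimension on the line\<close>

text \<open>The line is covered by intervals whose lengths form a scaled harmonic series: the
  lengths have infinite sum, so every point is reached, while their s-th powers have a finite sum
  that the scale makes arbitrarily small.\<close>

lemma hausdorff_measure_real_eq_0:
  fixes A :: "real set"
  assumes s: "s > 1"
  shows "hausdorff_measure s A = 0"
proof -
  have small: "hausdorff_premeasure s \<delta> A \<le> ennreal e" if \<delta>: "\<delta> > 0" and e: "e > 0" for \<delta> e
  proof -
    define z where "z n = real (Suc n) powr (-s)" for n
    have z_summable: "summable z"
      using summable_Suc_iff[of "\<lambda>n. real n powr (-s)"] s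
      by (simp add: summable_real_powr_iff z_def[abs_def])
    define Z where "Z = suminf z"
    have Z: "Z \<ge> 0"
      unfolding Z_def by (intro suminf_nonneg z_summable) (simp add: z_def)
    \<comment> \<open>Chosen so that \<open>(2 * \<epsilon>) powr s * Z \<le> e\<close>; the factor
      2 pays for using each length twice, once per half-line.\<close>
    define \<epsilon> where "\<epsilon> = min \<delta> ((e / (Z + 1)) powr (1 / s) / 2)"
    have \<epsilon>: "\<epsilon> > 0" "\<epsilon> \<le> \<delta>" using \<delta> e Z by (auto simp: \<epsilon>_def)
    have "(2 * \<epsilon>) powr s \<le> ((e / (Z + 1)) powr (1 / s)) powr s"
      using \<epsilon> s by (intro powr_mono2) (auto simp: \<epsilon>_def)
    also have "\<dots> = e / (Z + 1)" using s e Z by (simp add: powr_powr)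
    finally have \<epsilon>s: "(2 * \<epsilon>) powr s * Z \<le> e / (Z + 1) * Z"
      using Z by (rule mult_right_mono)
    also have "\<dots> \<le> e" using e Z by (simp add: field_simps)
    finally have \<epsilon>Z: "(2 * \<epsilon>) powr s * Z \<le> e" .
    define a where "a n = (\<Sum>i<n. \<epsilon> * inverse (real (Suc i)))" for n
    have a_Suc: "a (Suc n) = a n + \<epsilon> / real (Suc n)" for n by (simp add: a_def field_simps)
    \<comment> \<open>Even indices tile the nonnegative half-line, odd ones are the mirror images;
      hence \<open>i div 2\<close>.\<close>
    define U where "U i = (if even i then {a (i div 2)..a (Suc (i div 2))}
        else {- a (Suc (i div 2))..- a (i div 2)})" for i :: nat
    have diam: "diameter (U i) = \<epsilon> / real (Suc (i div 2))" for i
    proof -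
      have "0 \<le> \<epsilon> / real (Suc (i div 2))" using \<epsilon> by simp
      then show ?thesis by (auto simp: U_def a_Suc diameter_closed_interval simp del: of_nat_Suc)
    qed
    have between: "\<exists>k. a k \<le> y \<and> y \<le> a (Suc k)" if y: "y \<ge> 0" for y
    proof -
      have "\<exists>n. y < a n"
      proof (rule ccontr)
        assume "\<not> ?thesis"
        then have le: "a n \<le> y" for n by (simp add: not_less)
        have "summable (\<lambda>i. \<epsilon> * inverse (real (Suc i)))"
          using \<epsilon> le by (intro summableI_nonneg_bounded[where x = y]) (auto simp: a_def)
        then have "summable (\<lambda>i. inverse (real (Suc i)))" using \<epsilon> by simp
        then show False using not_summable_harmonic[where 'a = real] summable_Suc_iff[of "\<lambda>i. inverse (real i)"] by auto
      qed
      then have L: "y < a (LEAST n. y < a n)" by (rule LeastI_ex)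
      then obtain k where k: "(LEAST n. y < a n) = Suc k"
        using y by (cases "LEAST n. y < a n") (auto simp: a_def)
      then have "\<not> y < a k" using not_less_Least[of k "\<lambda>n. y < a n"] by simp
      then show ?thesis using L k by (intro exI[of _ k]) auto
    qed
    have "A \<subseteq> (\<Union>i. U i)"
    proof
      fix x :: real
      show "x \<in> (\<Union>i. U i)"
      proof (cases "x \<ge> 0")
        case True
        then obtain k where "a k \<le> x" "x \<le> a (Suc k)" using between by blast
        then have "x \<in> U (2 * k)" by (simp add: U_def)
        then show ?thesis by blast
      next
        case False
        then obtain k where "a k \<le> - x" "- x \<le> a (Suc k)" using between[of "- x"] by auto
        then have "x \<in> U (2 * k + 1)" by (simp add: U_def)
        then show ?thesis by blast
      qed
    qed
    moreover have "bounded (U i) \<and> diameter (U i) \<le> \<delta>" for i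
    proof -
      have "\<epsilon> / real (Suc (i div 2)) \<le> \<epsilon> / 1" using \<epsilon> by (intro divide_left_mono) auto
      then show ?thesis using \<epsilon> diam[of i] by (auto simp: U_def)
    qed
    ultimately have "hausdorff_premeasure s \<delta> A \<le> (\<Sum>i. ennreal (diameter (U i) powr s))"
      unfolding hausdorff_premeasure_def by (intro INF_lower) auto
    also have "\<dots> \<le> (\<Sum>i. ennreal ((2 * \<epsilon>) powr s * z i))"
    proof (intro suminf_le ennreal_leI)
      fix i
      have "\<epsilon> / real (Suc (i div 2)) \<le> 2 * \<epsilon> / real (Suc i)"
      proof -
        have "Suc i \<le> 2 * Suc (i div 2)" by presburger
        then have "real (Suc i) \<le> 2 * real (Suc (i div 2))"
          by (metis of_nat_le_iff of_nat_mult of_nat_numeral)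
        then have "\<epsilon> * real (Suc i) \<le> \<epsilon> * (2 * real (Suc (i div 2)))"
          using \<epsilon> by (intro mult_left_mono) auto
        then show ?thesis by (simp add: frac_le_eq divide_simps mult_ac del: of_nat_Suc)
      qed
      then have "diameter (U i) powr s \<le> (2 * \<epsilon> / real (Suc i)) powr s"
        unfolding diam using \<epsilon> s by (intro powr_mono2) auto
      also have "\<dots> = (2 * \<epsilon>) powr s * z i"
        using \<epsilon> by (simp add: powr_divide z_def powr_minus_divide)
      finally show "diameter (U i) powr s \<le> (2 * \<epsilon>) powr s * z i" .
    qed auto
    also have "\<dots> = ennreal ((2 * \<epsilon>) powr s * Z)"
      unfolding Z_def suminf_mult[OF z_summable, symmetric]
      by (intro suminf_ennreal2 summable_mult z_summable) (simp add: z_def)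
    also have "\<dots> \<le> ennreal e" by (intro ennreal_leI \<epsilon>Z)
    finally show ?thesis .
  qed
  have "hausdorff_premeasure s \<delta> A = 0" if "\<delta> > 0" for \<delta>
    using ennreal_le_epsilon[of 0 "hausdorff_premeasure s \<delta> A"] small[OF that] by simp
  then show ?thesis by (simp add: hausdorff_measure_def)
qed

text \<open>Exponents above 1 always give measure 0 on the line, so the upper bound is automatic and
  only exponents below 1 have to be examined.\<close>

lemma hausdorff_dim_real_eq_1I:
  fixes A :: "real set"
  assumes "\<And>s. 0 < s \<Longrightarrow> s < 1 \<Longrightarrow> hausdorff_measure s A \<noteq> 0"
  shows "hausdorff_dim A = 1"
proof (rule antisym)
  show "hausdorff_dim A \<le> 1"
  proof (rule ereal_le_epsilon2)
    fix e :: real assume "e > 0"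
    then have "hausdorff_dim A \<le> ereal (1 + e)"
      unfolding hausdorff_dim_def
      by (intro INF_lower) (auto intro: hausdorff_measure_real_eq_0)
    then show "hausdorff_dim A \<le> 1 + ereal e" by (simp add: one_ereal_def)
  qed
  show "1 \<le> hausdorff_dim A"
    unfolding hausdorff_dim_def
  proof (rule INF_greatest)
    fix s assume "s \<in> {s. s > 0 \<and> hausdorff_measure s A = 0}"
    then have "1 \<le> s" using assms[of s] by force
    then show "1 \<le> ereal s" by (simp add: one_ereal_def)
  qed
qed

text \<open>Were the measure 0, a cover with tiny sum of \<open>diameter powr s\<close> could be
  enclosed in intervals of total mass below 1, although these intervals carry almost all of the law
  of \<open>X\<close>.\<close>

lemma (in prob_space) mass_distribution_principle:
  fixes X :: "'a \<Rightarrow> real"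
  assumes X [measurable]: "X \<in> borel_measurable M"
    and A: "AE \<omega> in M. X \<omega> \<in> A"
    and s: "s > 0" and C: "C \<ge> 0"
    and mass: "\<And>a b. a < b \<Longrightarrow> b - a \<le> 1 \<Longrightarrow> prob {\<omega> \<in> space M. X \<omega> \<in> {a..b}} \<le> C * (b - a) powr s"
  shows "hausdorff_measure s A \<noteq> 0"
proof
  assume "hausdorff_measure s A = 0"
  moreover have "hausdorff_premeasure s (1/2) A \<le> hausdorff_measure s A"
    unfolding hausdorff_measure_def by (rule SUP_upper) simp
  \<comment> \<open>Sets of diameter at most 1/2 fit into intervals of length at most 1, where
    \<open>mass\<close> applies. The threshold keeps the total mass at most
    \<open>C * 2 powr s / (C * 2 powr s + 1)\<close>, which is below 1.\<close>
  ultimately have "hausdorff_premeasure s (1/2) A < ennreal (1 / (C * 2 powr s + 1))"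
    using C by (simp add: add_nonneg_pos)
  then obtain U where U: "A \<subseteq> (\<Union>i. U i)" "\<And>i. bounded (U i)" "\<And>i. diameter (U i) \<le> 1/2"
    and sum: "(\<Sum>i. ennreal (diameter (U i) powr s)) < ennreal (1 / (C * 2 powr s + 1))"
    unfolding hausdorff_premeasure_def INF_less_iff by auto
  \<comment> \<open>Covering sets may be single points, so the bound is extended to degenerate
    intervals by shrinking proper ones; \<open>0 powr s\<close> is 0.\<close>
  have mass': "prob {\<omega> \<in> space M. X \<omega> \<in> {a..b}} \<le> C * (b - a) powr s" if ab: "a \<le> b" "b - a \<le> 1" for a b
  proof (cases "a < b")
    case False
    have "(\<lambda>n. C * (1 / real (Suc n)) powr s) \<longlonglongrightarrow> C * 0 powr s"
      using s by (intro tendsto_intros LIMSEQ_Suc[OF lim_1_over_n]) auto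
    moreover have "prob {\<omega> \<in> space M. X \<omega> \<in> {a..b}} \<le> C * (1 / real (Suc n)) powr s" for n
    proof -
      have "prob {\<omega> \<in> space M. X \<omega> \<in> {a..b}} \<le> prob {\<omega> \<in> space M. X \<omega> \<in> {a..a + 1 / real (Suc n)}}"
        using False ab by (intro finite_measure_mono) (auto intro: order_trans)
      also have "\<dots> \<le> C * (a + 1 / real (Suc n) - a) powr s" by (intro mass) auto
      finally show ?thesis by simp
    qed
    ultimately have "prob {\<omega> \<in> space M. X \<omega> \<in> {a..b}} \<le> C * 0 powr s"
      by (intro LIMSEQ_le_const) auto
    moreover have "C * 0 powr s = C * (b - a) powr s" using False ab by simp
    ultimately show ?thesis by (simp only:)
  qed (use mass ab in auto)
  \<comment> \<open>A set of diameter r lies within distance r of any of its points. For an empty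
    set the centre is arbitrary and the inclusion is trivial.\<close>
  define J where "J i = (let y = (SOME y. y \<in> U i) in {y - diameter (U i)..y + diameter (U i)})" for i
  have UJ: "U i \<subseteq> J i" for i
  proof
    fix x assume x: "x \<in> U i"
    then have "(SOME y. y \<in> U i) \<in> U i" by (rule someI)
    then have "dist x (SOME y. y \<in> U i) \<le> diameter (U i)"
      using x U(2) by (intro diameter_bounded_bound) auto
    then show "x \<in> J i" by (auto simp: J_def Let_def dist_real_def)
  qed
  have J: "emeasure M {\<omega> \<in> space M. X \<omega> \<in> J i} \<le> ennreal (C * 2 powr s) * ennreal (diameter (U i) powr s)" for i
  proof -
    have "0 \<le> diameter (U i)" by (rule diameter_ge_0[OF U(2)])
    then have "prob {\<omega> \<in> space M. X \<omega> \<in> J i} \<le> C * (2 * diameter (U i)) powr s"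
      using mass'[of "(SOME y. y \<in> U i) - diameter (U i)" "(SOME y. y \<in> U i) + diameter (U i)"] U(3)[of i]
      by (simp add: J_def Let_def)
    then show ?thesis
      using C \<open>0 \<le> diameter (U i)\<close>
      by (simp add: emeasure_eq_measure powr_mult mult.assoc ennreal_mult'[symmetric])
  qed
  have [measurable]: "J i \<in> sets borel" for i by (simp add: J_def Let_def)
  have "1 = emeasure M (space M)" by (simp add: emeasure_space_1)
  also have "\<dots> \<le> emeasure M (\<Union>i. {\<omega> \<in> space M. X \<omega> \<in> J i})"
  proof (rule emeasure_mono_AE)
    show "AE \<omega> in M. \<omega> \<in> space M \<longrightarrow> \<omega> \<in> (\<Union>i. {\<omega> \<in> space M. X \<omega> \<in> J i})"
      using A U(1) UJ by (auto elim!: eventually_mono) blast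
  qed auto
  also have "\<dots> \<le> (\<Sum>i. emeasure M {\<omega> \<in> space M. X \<omega> \<in> J i})"
    by (intro emeasure_subadditive_countably) auto
  also have "\<dots> \<le> (\<Sum>i. ennreal (C * 2 powr s) * ennreal (diameter (U i) powr s))"
    by (intro suminf_le J) auto
  also have "\<dots> = ennreal (C * 2 powr s) * (\<Sum>i. ennreal (diameter (U i) powr s))" by simp
  also have "\<dots> \<le> ennreal (C * 2 powr s) * ennreal (1 / (C * 2 powr s + 1))"
    using sum by (intro mult_left_mono) auto
  also have "\<dots> = ennreal (C * 2 powr s / (C * 2 powr s + 1))"
    using C by (simp add: ennreal_mult'[symmetric])
  also have "\<dots> < 1"
    using C by (subst ennreal_less_one_iff) (simp add: divide_less_eq add_nonneg_pos)
  finally show False by simp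
qed

section \<open>Digits and shifts\<close>

definition cantor_base :: "(nat \<Rightarrow> nat) \<Rightarrow> nat \<Rightarrow> nat" where
  "cantor_base Q n = (\<Prod>j=1..n. Q j)"

text \<open>The first \<open>n\<close> digits read as a mixed-radix numeral by Horner's scheme; for
  admissible digits this is the integer part of the value scaled by
  \<open>cantor_base Q n\<close>.\<close>

primrec cantor_prefix :: "(nat \<Rightarrow> nat) \<Rightarrow> (nat \<Rightarrow> nat) \<Rightarrow> nat \<Rightarrow> nat" where
  "cantor_prefix Q E 0 = 0"
| "cantor_prefix Q E (Suc n) = Q (Suc n) * cantor_prefix Q E n + E (Suc n)"

definition cantor_value :: "(nat \<Rightarrow> nat) \<Rightarrow> (nat \<Rightarrow> nat) \<Rightarrow> real" where
  "cantor_value Q E = (\<Sum>n. real (E (Suc n)) / real (cantor_base Q (Suc n)))"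

text \<open>The digit conditions of an expansion, detached from any number so that random sequences
  can be tested for them.\<close>

definition admissible_digits :: "(nat \<Rightarrow> nat) \<Rightarrow> (nat \<Rightarrow> nat) \<Rightarrow> bool" where
  "admissible_digits Q E \<longleftrightarrow>
     E 0 = 0 \<and> (\<forall>n\<ge>1. E n < Q n) \<and> infinite {n. n \<ge> 1 \<and> E n \<noteq> Q n - 1}"

lemma cantor_base_0 [simp]: "cantor_base Q 0 = 1"
  and cantor_base_Suc [simp]: "cantor_base Q (Suc n) = cantor_base Q n * Q (Suc n)"
  by (simp_all add: cantor_base_def)

lemma cantor_shift_eq: "cantor_shift Q n x = frac (real (cantor_base Q n) * x)"
  by (simp add: cantor_shift_def cantor_base_def)

lemma basic_sequence_Suc: "basic_sequence Q \<Longrightarrow> Q (Suc n) \<ge> 2"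
  by (simp add: basic_sequence_def)

lemma cantor_base_ge: "basic_sequence Q \<Longrightarrow> cantor_base Q n \<ge> 2 ^ n"
proof (induction n)
  case (Suc n)
  then have "2 ^ n * 2 \<le> cantor_base Q n * Q (Suc n)"
    by (intro mult_mono basic_sequence_Suc) auto
  then show ?case by (simp add: mult.commute)
qed simp

lemma cantor_base_pos: "basic_sequence Q \<Longrightarrow> cantor_base Q n > 0"
  using cantor_base_ge[of Q n] by (meson less_le_trans zero_less_numeral zero_less_power)

lemma cantor_base_mono: "basic_sequence Q \<Longrightarrow> m \<le> n \<Longrightarrow> cantor_base Q m \<le> cantor_base Q n"
proof (rule lift_Suc_mono_le[of "cantor_base Q"])
  fix n assume "basic_sequence Q"
  from basic_sequence_Suc[OF this, of n]
  show "cantor_base Q n \<le> cantor_base Q (Suc n)" by simp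
qed

lemma tendsto_inverse_cantor_base:
  assumes "basic_sequence Q"
  shows "(\<lambda>n. 1 / real (cantor_base Q n)) \<longlonglongrightarrow> 0"
proof (rule tendsto_sandwich[OF _ _ tendsto_const])
  show "(\<lambda>n. (1/2::real) ^ n) \<longlonglongrightarrow> 0" by (rule LIMSEQ_realpow_zero) auto
  show "\<forall>\<^sub>F n in sequentially. 1 / real (cantor_base Q n) \<le> (1/2) ^ n"
  proof (intro always_eventually allI)
    fix n
    have "2 ^ n \<le> real (cantor_base Q n)"
      using cantor_base_ge[OF assms, of n] by (metis of_nat_le_iff of_nat_numeral of_nat_power)
    then have "1 / real (cantor_base Q n) \<le> 1 / 2 ^ n" by (intro frac_le) auto
    then show "1 / real (cantor_base Q n) \<le> (1/2) ^ n" by (simp add: power_divide)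
  qed
qed auto

text \<open>The tail after \<open>n\<close> digits is nonnegative and, by comparison with a
  telescoping series, less than one unit of the \<open>n\<close>-th place.\<close>

lemma cantor_value_bounds:
  assumes Q: "basic_sequence Q" and E: "admissible_digits Q E"
  shows "real (cantor_prefix Q E n) \<le> real (cantor_base Q n) * cantor_value Q E"
    and "real (cantor_base Q n) * cantor_value Q E < real (cantor_prefix Q E n) + 1"
    and "summable (\<lambda>n. real (E (Suc n)) / real (cantor_base Q (Suc n)))"
proof -
  let ?P = "\<lambda>n. real (cantor_base Q n)"
  define f where "f n = real (E (Suc n)) / ?P (Suc n)" for n
  \<comment> \<open>\<open>g n\<close> is the contribution of the largest possible digit; its tails
    telescope to \<open>1 / cantor_base Q n\<close>.\<close>
  define g where "g n = 1 / ?P n - 1 / ?P (Suc n)" for n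
  have P: "?P n > 0" for n using cantor_base_pos[OF Q] by simp
  have Q2: "real (Q (Suc n)) \<ge> 2" for n using basic_sequence_Suc[OF Q, of n] by simp
  have g: "g n = (real (Q (Suc n)) - 1) / ?P (Suc n)" for n
    using P[of n] Q2[of n] by (simp add: g_def field_simps)
  have f0: "0 \<le> f n" for n by (simp add: f_def)
  have El: "E (Suc n) < Q (Suc n)" for n using E by (simp add: admissible_digits_def)
  have fg: "f n \<le> g n" for n
    using El[of n] P[of "Suc n"] unfolding f_def g by (intro divide_right_mono) linarith+
  have gs: "(\<lambda>i. g (i + n)) sums (1 / ?P n)" for n
    using telescope_sums'[OF LIMSEQ_ignore_initial_segment[OF tendsto_inverse_cantor_base[OF Q], of n]]
    by (simp add: g_def)
  then have gsum: "summable (\<lambda>i. g (i + n))" for n by (rule sums_summable)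
  have fs: "summable f"
    using gsum[of 0] f0 fg by (intro summable_comparison_test'[of g 0 f]) auto
  then show "summable (\<lambda>n. real (E (Suc n)) / real (cantor_base Q (Suc n)))"
    by (simp add: f_def[abs_def])
  have fs': "summable (\<lambda>i. f (i + n))" using fs by (rule summable_ignore_initial_segment)
  have part: "(\<Sum>i<n. f i) = real (cantor_prefix Q E n) / ?P n" for n
  proof (induction n)
    case (Suc n)
    then show ?case using P[of n] Q2[of n] by (simp add: f_def field_simps)
  qed simp
  have V: "cantor_value Q E = (\<Sum>i. f (i + n)) + real (cantor_prefix Q E n) / ?P n"
    unfolding cantor_value_def part[symmetric] f_def[symmetric]
    by (rule suminf_split_initial_segment[OF fs])
  have "0 \<le> (\<Sum>i. f (i + n))" using fs' f0 by (intro suminf_nonneg) auto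
  then show "real (cantor_prefix Q E n) \<le> ?P n * cantor_value Q E"
    using P[of n] by (simp add: V field_simps)
  \<comment> \<open>A later digit that is not maximal makes the comparison strict.\<close>
  have "\<exists>m. m > n \<and> m \<ge> 1 \<and> E m \<noteq> Q m - 1"
    using E unfolding admissible_digits_def infinite_nat_iff_unbounded by blast
  then obtain m where m: "m > n" "E m \<noteq> Q m - 1" by blast
  define k where "k = m - Suc n"
  have "m = Suc (k + n)" using m by (simp add: k_def)
  then have "E (Suc (k + n)) \<noteq> Q (Suc (k + n)) - 1" using m by simp
  then have "real (E (Suc (k + n))) < real (Q (Suc (k + n))) - 1"
    using El[of "k + n"] by linarith
  then have "f (k + n) < g (k + n)"
    using P[of "Suc (k + n)"] unfolding f_def g by (intro divide_strict_right_mono)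
  then have "0 < (\<Sum>i. g (i + n) - f (i + n))"
    using fg by (intro suminf_pos2[where i = k] summable_diff gsum fs') auto
  also have "\<dots> = 1 / ?P n - (\<Sum>i. f (i + n))"
    using suminf_diff[OF gsum fs'] sums_unique[OF gs[of n]] by simp
  finally show "?P n * cantor_value Q E < real (cantor_prefix Q E n) + 1"
    using P[of n] by (simp add: V field_simps)
qed

lemma cantor_digits_cantor_value:
  assumes Q: "basic_sequence Q" and E: "admissible_digits Q E"
  shows "cantor_digits Q (cantor_value Q E) = E"
proof -
  have "\<lfloor>cantor_value Q E\<rfloor> = 0"
    using cantor_value_bounds(1,2)[OF Q E, of 0] by (simp add: floor_eq_iff)
  moreover have "(\<lambda>n. real (E (Suc n)) / real (cantor_base Q (Suc n))) sums cantor_value Q E"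
    unfolding cantor_value_def by (rule summable_sums[OF cantor_value_bounds(3)[OF Q E]])
  ultimately have "cantor_expansion Q (cantor_value Q E) E"
    using E unfolding cantor_expansion_def admissible_digits_def
    by (auto simp: cantor_base_def simp del: cantor_base_Suc prod.cl_ivl_Suc)
  then show ?thesis
    using cantor_expansion_unique[OF Q cantor_expansion_cantor_digits[OF Q]] by blast
qed

lemma admissible_cantor_digits:
  assumes Q: "basic_sequence Q"
  shows "admissible_digits Q (cantor_digits Q x)"
    and "cantor_value Q (cantor_digits Q x) = frac x"
proof -
  have E: "cantor_expansion Q x (cantor_digits Q x)" by (rule cantor_expansion_cantor_digits[OF Q])
  have "cantor_digits Q x n < Q n" if "n \<ge> 1" for n
  proof -
    have "Q n \<ge> 2" "cantor_digits Q x n \<le> Q n - 1"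
      using that Q E by (auto simp: basic_sequence_def cantor_expansion_def)
    then show ?thesis by linarith
  qed
  then show "admissible_digits Q (cantor_digits Q x)"
    using E by (simp add: admissible_digits_def cantor_expansion_def)
  show "cantor_value Q (cantor_digits Q x) = frac x"
    using E unfolding cantor_value_def cantor_expansion_def frac_def
    by (intro sums_unique[symmetric])
      (simp add: cantor_base_def del: cantor_base_Suc prod.cl_ivl_Suc)
qed

text \<open>The shift is the scaled fractional part minus its prefix, so the prefix bounds at level
  \<open>Suc n\<close> exhibit the next digit as the integer part of the base times the shift. This
  ties digit frequencies to shift frequencies.\<close>

lemma cantor_digits_bounds:
  assumes Q: "basic_sequence Q"
  shows "real (cantor_digits Q x (Suc n)) \<le> real (Q (Suc n)) * cantor_shift Q n x"
    and "real (Q (Suc n)) * cantor_shift Q n x < real (cantor_digits Q x (Suc n)) + 1"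
proof -
  let ?E = "cantor_digits Q x" and ?P = "real (cantor_base Q n)"
  note E = admissible_cantor_digits[OF Q, of x]
  note b = cantor_value_bounds(1,2)[OF Q E(1), unfolded E(2)]
  have "?P * x = ?P * frac x + of_int (int (cantor_base Q n) * \<lfloor>x\<rfloor>)"
    by (simp add: frac_def algebra_simps)
  also have "frac \<dots> = frac (?P * frac x)"
    unfolding frac_def by (simp only: floor_add_int[symmetric] of_int_add)
  also have "\<dots> = ?P * frac x - real (cantor_prefix Q ?E n)"
  proof -
    have "\<lfloor>?P * frac x\<rfloor> = int (cantor_prefix Q ?E n)" using b[of n] by (intro floor_unique) auto
    then show ?thesis by (simp only: frac_def[of "?P * frac x"] of_int_of_nat_eq)
  qed
  finally have shift: "cantor_shift Q n x = ?P * frac x - real (cantor_prefix Q ?E n)"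
    by (simp add: cantor_shift_eq)
  show "real (?E (Suc n)) \<le> real (Q (Suc n)) * cantor_shift Q n x"
    and "real (Q (Suc n)) * cantor_shift Q n x < real (?E (Suc n)) + 1"
    using b[of "Suc n"] by (simp_all add: shift algebra_simps)
qed

lemma cantor_digits_Suc:
  assumes "basic_sequence Q"
  shows "cantor_digits Q x (Suc n) = nat \<lfloor>real (Q (Suc n)) * cantor_shift Q n x\<rfloor>"
  using cantor_digits_bounds[OF assms, where x = x and n = n]
    floor_unique[of "int (cantor_digits Q x (Suc n))" "real (Q (Suc n)) * cantor_shift Q n x"]
  by simp

text \<open>The last digit is the remainder modulo the last base, so digits can be peeled off from
  the end.\<close>

lemma cantor_prefix_inj:
  assumes "cantor_prefix Q E n = cantor_prefix Q F n"
    and "\<And>i. i \<in> {1..n} \<Longrightarrow> E i < Q i" and "\<And>i. i \<in> {1..n} \<Longrightarrow> F i < Q i"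
    and "i \<in> {1..n}"
  shows "E i = F i"
  using assms
proof (induction n arbitrary: i)
  case (Suc n)
  have "E (Suc n) < Q (Suc n)" "F (Suc n) < Q (Suc n)" using Suc.prems by auto
  moreover have eq: "Q (Suc n) * cantor_prefix Q E n + E (Suc n) = Q (Suc n) * cantor_prefix Q F n + F (Suc n)"
    using Suc.prems(1) by simp
  ultimately have "E (Suc n) = F (Suc n)"
    by (metis mod_mult_self4 mod_less)
  moreover from this eq have "cantor_prefix Q E n = cantor_prefix Q F n"
    using \<open>E (Suc n) < Q (Suc n)\<close> by auto
  ultimately show ?case
    using Suc.IH[of i] Suc.prems by (cases "i = Suc n") auto
qed simp

text \<open>Finitely many zeros have only finitely many successors, so some block
  \<open>[0, b]\<close> never occurs.\<close>

lemma not_normal_if_finite_zeros: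
  assumes fin: "finite {n. n \<ge> 1 \<and> cantor_digits Q x n = 0}"
  shows "x \<notin> ratio_normal_numbers Q" and "x \<notin> normal_numbers Q"
proof -
  let ?Z = "{n. n \<ge> 1 \<and> cantor_digits Q x n = 0}"
  have no: "\<exists>b. \<forall>n. block_count Q n [0, b] x = 0"
  proof (rule ccontr)
    assume *: "\<not> ?thesis"
    have ex: "\<exists>i. i \<in> ?Z \<and> cantor_digits Q x (Suc i) = b" for b
    proof -
      obtain n where "block_count Q n [0, b] x \<noteq> 0" using * by blast
      then have "{i \<in> {1..n}. \<forall>m<length [0, b]. cantor_digits Q x (i + m) = [0, b] ! m} \<noteq> {}"
        unfolding block_count_def by (metis card.empty)
      then obtain i where i: "i \<ge> 1" "\<And>m. m < 2 \<Longrightarrow> cantor_digits Q x (i + m) = [0, b] ! m" by auto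
      from i(2)[of 0] i(2)[of 1] i(1) show ?thesis by auto
    qed
    have "(UNIV :: nat set) \<subseteq> (\<lambda>i. cantor_digits Q x (Suc i)) ` ?Z"
    proof
      fix b
      obtain i where "i \<in> ?Z" "cantor_digits Q x (Suc i) = b" using ex by blast
      then show "b \<in> (\<lambda>i. cantor_digits Q x (Suc i)) ` ?Z" by blast
    qed
    then show False using fin by (meson finite_surj infinite_UNIV_nat)
  qed
  then obtain b where b: "block_count Q n [0, b] x = 0" for n by blast
  show "x \<notin> ratio_normal_numbers Q"
  proof
    assume "x \<in> ratio_normal_numbers Q"
    then have "x \<in> ratio_normal_order 2 Q" by (auto simp: ratio_normal_numbers_def)
    \<comment> \<open>With the same block on both sides every quotient is 0 / 0, which is 0 by
      convention.\<close>
    then have "(\<lambda>n. real (block_count Q n [0, b] x) / real (block_count Q n [0, b] x)) \<longlonglongrightarrow> 1"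
      unfolding ratio_normal_order_def by (auto simp del: divide_self_if)
    then show False by (simp add: b LIMSEQ_const_iff)
  qed
  show "x \<notin> normal_numbers Q"
  proof
    assume "x \<in> normal_numbers Q"
    then have "x \<in> normal_order 2 Q" by (auto simp: normal_numbers_def)
    then have "(\<lambda>n. real (block_count Q n [0, b] x) / block_weight Q 2 n) \<longlonglongrightarrow> 1"
      unfolding normal_order_def by auto
    then show False by (simp add: b LIMSEQ_const_iff)
  qed
qed

section \<open>Equidistribution of digits\<close>

text \<open>Rational thresholds leave countably many almost sure conditions. The steps
  \<open>t\<close> serve block products, which sample the shifts along multiples of
  \<open>t\<close>; \<open>Suc (t * n)\<close> is the position of the digit read off the shift of
  index \<open>t * n\<close>.\<close>

definition digits_equidistributed :: "(nat \<Rightarrow> nat) \<Rightarrow> (nat \<Rightarrow> nat) \<Rightarrow> bool" where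
  "digits_equidistributed Q E \<longleftrightarrow>
     (\<forall>t\<ge>1. \<forall>c\<in>\<rat>. 0 < c \<and> c < 1 \<longrightarrow>
        (\<lambda>N. real (card {n. n < N \<and> real (E (Suc (t * n))) < c * real (Q (Suc (t * n)))}) / real N)
          \<longlonglongrightarrow> c)"

text \<open>A maximal digit is at least half of its base, so eventually maximal digits would fall
  below one half of the base with frequency 0 instead of 1/2.\<close>

lemma digits_equidistributed_infinite:
  assumes Q: "basic_sequence Q" and E: "digits_equidistributed Q E"
  shows "infinite {n. n \<ge> 1 \<and> E n \<noteq> Q n - 1}"
proof
  assume fin: "finite {n. n \<ge> 1 \<and> E n \<noteq> Q n - 1}"
  let ?S = "{n. real (E (Suc n)) < 1/2 * real (Q (Suc n))}"
  have "Suc ` ?S \<subseteq> {n. n \<ge> 1 \<and> E n \<noteq> Q n - 1}"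
  proof safe
    fix n assume "real (E (Suc n)) < 1/2 * real (Q (Suc n))" "E (Suc n) = Q (Suc n) - 1"
    then show False using basic_sequence_Suc[OF Q, of n] by (simp add: of_nat_diff field_simps)
  qed simp
  then have "finite (Suc ` ?S)" using fin by (rule finite_subset)
  then have finS: "finite ?S" by (rule finite_imageD) simp
  have "(\<lambda>N. real (card {n. n < N \<and> real (E (Suc n)) < 1/2 * real (Q (Suc n))}) / real N) \<longlonglongrightarrow> 1/2"
    using E[unfolded digits_equidistributed_def, rule_format, of 1 "1/2"] by simp
  moreover have "(\<lambda>N. real (card {n. n < N \<and> real (E (Suc n)) < 1/2 * real (Q (Suc n))}) / real N) \<longlonglongrightarrow> 0"
  proof (rule tendsto_sandwich[OF _ _ tendsto_const])
    show "(\<lambda>N. real (card ?S) / real N) \<longlonglongrightarrow> 0" by (rule lim_const_over_n)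
    show "\<forall>\<^sub>F N in sequentially. real (card {n. n < N \<and> real (E (Suc n)) < 1/2 * real (Q (Suc n))}) / real N
        \<le> real (card ?S) / real N"
    proof (intro always_eventually allI divide_right_mono of_nat_mono)
      fix N
      show "card {n. n < N \<and> real (E (Suc n)) < 1/2 * real (Q (Suc n))} \<le> card ?S"
        by (intro card_mono finS) auto
    qed auto
  qed auto
  ultimately have "(1/2 :: real) = 0" by (rule LIMSEQ_unique)
  then show False by simp
qed

text \<open>A digit divided by its base approximates the shift from below, within the reciprocal of
  the base, which tends to 0. Rational thresholds on either side of \<open>b\<close> then squeeze
  the frequency of shifts below \<open>b\<close>.\<close>

lemma uniformly_distributed_cantor_shift:
  assumes Q: "basic_sequence Q" and lim: "infinite_in_limit Q"
    and E: "digits_equidistributed Q (cantor_digits Q x)" and t: "t \<ge> 1"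
  shows "uniformly_distributed_mod1 (\<lambda>n. cantor_shift Q (t * n) x)"
proof -
  define T where "T n = cantor_shift Q (t * n) x" for n
  define q where "q n = real (Q (Suc (t * n)))" for n
  define e where "e n = real (cantor_digits Q x (Suc (t * n)))" for n
  define F where "F c N = real (card {n. n < N \<and> e n < c * q n}) / real N" for c N
  define G where "G b N = real (card {n. n < N \<and> T n < b}) / real N" for b N
  have q: "q n > 0" for n using basic_sequence_Suc[OF Q, of "t * n"] by (simp add: q_def)
  have eT: "e n \<le> q n * T n" "q n * T n < e n + 1" for n
    using cantor_digits_bounds[OF Q] by (auto simp: e_def q_def T_def)
  have T01: "0 \<le> T n" "T n < 1" for n by (auto simp: T_def cantor_shift_def frac_lt_1)
  have F: "F c \<longlonglongrightarrow> c" if "c \<in> \<rat>" "0 < c" "c < 1" for c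
    using E t that unfolding digits_equidistributed_def F_def e_def q_def by blast
  have "filterlim (\<lambda>n. Q (Suc (t * n))) at_top sequentially"
    using lim unfolding infinite_in_limit_def
    by (rule filterlim_compose)
      (use t in \<open>auto intro!: filterlim_subseq simp: strict_mono_def\<close>)
  then have qlim: "filterlim q at_top sequentially"
    unfolding q_def by (rule filterlim_compose[OF filterlim_real_sequentially])
  have G: "G b \<longlonglongrightarrow> b" if b: "0 \<le> b" "b \<le> 1" for b
  proof (rule order_tendstoI)
    fix u assume u: "b < u"
    show "\<forall>\<^sub>F N in sequentially. G b N < u"
    \<comment> \<open>Thresholds must lie strictly between 0 and 1, so none exceeds
      \<open>b = 1\<close>; there the trivial bound 1 is used.\<close>
    proof (cases "b = 1")
      case True
      have "G b N \<le> 1" for N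
      proof -
        have "card {n. n < N \<and> T n < b} \<le> card {..<N}" by (intro card_mono) auto
        then show ?thesis by (simp add: G_def divide_le_eq)
      qed
      then show ?thesis using True u by (intro always_eventually allI) (auto intro: le_less_trans)
    next
      case False
      then obtain c where c: "c \<in> \<rat>" "b < c" "c < min 1 u"
        using Rats_dense_in_real[of b "min 1 u"] b u by auto
      have "G b N \<le> F c N" for N
      proof -
        have "e n < c * q n" if "T n < b" for n
        proof -
          have "q n * T n < q n * c" using that c q[of n] by (intro mult_strict_left_mono) auto
          then show ?thesis using eT(1)[of n] by (simp add: mult.commute)
        qed
        then have "card {n. n < N \<and> T n < b} \<le> card {n. n < N \<and> e n < c * q n}"
          by (intro card_mono) auto
        then show ?thesis by (simp add: G_def F_def divide_right_mono)
      qed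
      moreover have "\<forall>\<^sub>F N in sequentially. F c N < u"
        using F[of c] c b by (intro order_tendstoD(2)) auto
      ultimately show ?thesis by (auto elim!: eventually_mono intro: le_less_trans)
    qed
  next
    fix l assume l: "l < b"
    show "\<forall>\<^sub>F N in sequentially. l < G b N"
    proof (cases "b = 0")
      case True
      have "0 \<le> G b N" for N by (simp add: G_def)
      then show ?thesis using True l by (intro always_eventually allI) (auto intro: less_le_trans)
    next
      case False
      then obtain c where c: "c \<in> \<rat>" "max 0 l < c" "c < b"
        using Rats_dense_in_real[of "max 0 l" b] b l by auto
      have "\<forall>\<^sub>F n in sequentially. 1 / (b - c) \<le> q n"
        using qlim by (simp add: filterlim_at_top)
      \<comment> \<open>From index \<open>m\<close> on the approximation error is at most
        \<open>b - c\<close>; the earlier indices cost at most \<open>m / N\<close>.\<close>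
      then obtain m where m: "\<And>n. n \<ge> m \<Longrightarrow> 1 / (b - c) \<le> q n"
        unfolding eventually_sequentially by blast
      have le: "F c N - real m / real N \<le> G b N" for N
      proof -
        have "T n < b" if "e n < c * q n" "n \<ge> m" for n
        proof -
          have "1 \<le> (b - c) * q n" using m[OF that(2)] c by (simp add: field_simps)
          then have "q n * T n < q n * b" using eT(2)[of n] that(1) by (simp add: algebra_simps)
          then show ?thesis using q[of n] by simp
        qed
        then have "{n. n < N \<and> e n < c * q n} \<subseteq> {n. n < N \<and> T n < b} \<union> {..<m}" by force
        then have "card {n. n < N \<and> e n < c * q n} \<le> card ({n. n < N \<and> T n < b} \<union> {..<m})"
          by (intro card_mono) auto
        also have "\<dots> \<le> card {n. n < N \<and> T n < b} + m"
          using card_Un_le[of "{n. n < N \<and> T n < b}" "{..<m}"] by simp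
        finally have "real (card {n. n < N \<and> e n < c * q n}) / real N
            \<le> (real (card {n. n < N \<and> T n < b}) + real m) / real N"
          by (intro divide_right_mono) auto
        then show ?thesis by (simp add: F_def G_def add_divide_distrib)
      qed
      have "(\<lambda>N. F c N - real m / real N) \<longlonglongrightarrow> c - 0"
        using c b by (intro tendsto_diff F lim_const_over_n) auto
      then have "\<forall>\<^sub>F N in sequentially. l < F c N - real m / real N"
        using c by (intro order_tendstoD(1)) auto
      then show ?thesis using le by (auto elim!: eventually_mono intro: less_le_trans)
    qed
  qed
  show ?thesis
    unfolding uniformly_distributed_mod1_def
  proof (intro allI impI)
    fix a b :: real assume ab: "0 \<le> a \<and> a < b \<and> b \<le> 1"
    have "real (card {n. n < N \<and> frac (cantor_shift Q (t * n) x) \<in> {a..<b}}) / real N = G b N - G a N" for N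
    proof -
      have "{n. n < N \<and> frac (cantor_shift Q (t * n) x) \<in> {a..<b}} = {n. n < N \<and> T n < b} - {n. n < N \<and> T n < a}"
        using T01 by (auto simp: T_def[symmetric] frac_eq[THEN iffD2])
      moreover have "card ({n. n < N \<and> T n < b} - {n. n < N \<and> T n < a})
          = card {n. n < N \<and> T n < b} - card {n. n < N \<and> T n < a}"
        using ab by (intro card_Diff_subset) auto
      moreover have "card {n. n < N \<and> T n < a} \<le> card {n. n < N \<and> T n < b}"
        using ab by (intro card_mono) auto
      ultimately show ?thesis by (simp add: G_def of_nat_diff diff_divide_distrib)
    qed
    then show "(\<lambda>N. real (card {n. n < N \<and> frac (cantor_shift Q (t * n) x) \<in> {a..<b}}) / real N) \<longlonglongrightarrow> b - a"
      using ab by (simp add: tendsto_diff G)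
  qed
qed

section \<open>A strong law for bounded independent variables\<close>

lemma cesaro_mean_tendsto:
  fixes h :: "nat \<Rightarrow> real"
  assumes "h \<longlonglongrightarrow> c"
  shows "(\<lambda>N. (\<Sum>n<N. h n) / real N) \<longlonglongrightarrow> c"
proof (rule LIMSEQ_I)
  fix e :: real assume e: "e > 0"
  obtain m where m: "\<And>n. n \<ge> m \<Longrightarrow> \<bar>h n - c\<bar> < e / 2"
    using LIMSEQ_D[OF assms, of "e / 2"] e by auto
  define K where "K = (\<Sum>n<m. \<bar>h n - c\<bar>)"
  have K: "K \<ge> 0" by (simp add: K_def sum_nonneg)
  have bound: "\<bar>(\<Sum>n<N. h n) - real N * c\<bar> \<le> K + real N * (e / 2)" for N
  proof -
    have "\<bar>(\<Sum>n<N. h n) - real N * c\<bar> = \<bar>\<Sum>n<N. h n - c\<bar>" by (simp add: sum_subtractf)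
    also have "\<dots> \<le> (\<Sum>n<N. \<bar>h n - c\<bar>)" by (rule sum_abs)
    also have "\<dots> \<le> (\<Sum>n<N. (if n < m then \<bar>h n - c\<bar> else 0) + e / 2)"
      using m e by (intro sum_mono) (auto intro: less_imp_le)
    also have "\<dots> = (\<Sum>n<N. if n < m then \<bar>h n - c\<bar> else 0) + real N * (e / 2)"
      by (simp add: sum.distrib)
    also have "(\<Sum>n<N. if n < m then \<bar>h n - c\<bar> else 0) = (\<Sum>n\<in>{..<N} \<inter> {..<m}. \<bar>h n - c\<bar>)"
      by (subst sum.inter_restrict) auto
    also have "\<dots> \<le> K" unfolding K_def by (intro sum_mono2) auto
    finally show ?thesis by simp
  qed
  obtain n0 where n0: "2 * K / e < real n0" using reals_Archimedean2 by blast
  show "\<exists>no. \<forall>N\<ge>no. norm ((\<Sum>n<N. h n) / real N - c) < e"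
  proof (intro exI allI impI)
    fix N assume N: "N \<ge> Suc n0"
    then have "2 * K < e * real N" using n0 e by (simp add: field_simps) (smt (verit) mult_left_mono of_nat_le_iff Suc_leD)
    then have "\<bar>(\<Sum>n<N. h n) - real N * c\<bar> < e * real N"
      using bound[of N] by (simp add: algebra_simps)
    moreover have "(\<Sum>n<N. h n) / real N - c = ((\<Sum>n<N. h n) - real N * c) / real N"
      using N by (simp add: field_simps)
    ultimately show "norm ((\<Sum>n<N. h n) / real N - c) < e"
      using N by (simp add: pos_divide_less_eq)
  qed
qed

text \<open>Hoeffding's inequality makes deviations of size \<open>e * N\<close> exponentially rare,
  so by Borel-Cantelli they eventually cease; \<open>e\<close> runs through a null sequence. The
  injection \<open>f\<close> selects a subsequence of the independent family.\<close>

lemma (in prob_space) strong_law_bounded: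
  fixes Y :: "'i \<Rightarrow> 'a \<Rightarrow> real" and f :: "nat \<Rightarrow> 'i"
  assumes indep: "indep_vars (\<lambda>_. borel) Y UNIV" and f: "inj f"
    and Y01: "\<And>i \<omega>. Y i \<omega> \<in> {0..1}"
  shows "AE \<omega> in M. (\<lambda>N. (\<Sum>n<N. Y (f n) \<omega> - expectation (Y (f n))) / real N) \<longlonglongrightarrow> 0"
proof -
  have [measurable]: "Y i \<in> borel_measurable M" for i
    using indep by (simp add: indep_vars_def)
  have ev: "AE \<omega> in M. \<forall>\<^sub>F N in sequentially.
      \<bar>\<Sum>n<N. Y (f n) \<omega> - expectation (Y (f n))\<bar> < e * real N" if e: "e > 0" for e
  proof -
    define A where "A N = {\<omega> \<in> space M. \<bar>\<Sum>n<N. Y (f n) \<omega> - expectation (Y (f n))\<bar> \<ge> e * real N}" for N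
    have A: "prob (A N) \<le> 2 * exp (- 2 * e\<^sup>2) ^ N" for N
    \<comment> \<open>The Hoeffding bound divides by the sum of the squared ranges, which is
      \<open>N\<close>.\<close>
    proof (cases "N = 0")
      case True
      then show ?thesis using order_trans[OF prob_le_1[of "A N"], of 2] by simp
    next
      case False
      interpret Hoeffding_ineq M "f ` {..<N}" Y "\<lambda>_. 0" "\<lambda>_. 1" "\<Sum>i\<in>f ` {..<N}. expectation (Y i)"
        by unfold_locales (use Y01 in \<open>auto intro: indep_vars_subset[OF indep]\<close>)
      have inj: "inj_on f {..<N}" using f by (rule inj_on_subset) simp
      have card: "card (f ` {..<N}) = N" using card_image[OF inj] by simp
      have "A N = {\<omega> \<in> space M. \<bar>(\<Sum>i\<in>f ` {..<N}. Y i \<omega>) - (\<Sum>i\<in>f ` {..<N}. expectation (Y i))\<bar> \<ge> e * real N}"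
        by (simp add: A_def sum.reindex[OF inj] sum_subtractf)
      then have "prob (A N) \<le> 2 * exp (- 2 * (e * real N)\<^sup>2 / (\<Sum>i\<in>f ` {..<N}. (1 - 0)\<^sup>2))"
        using Hoeffding_ineq_abs_ge[of "e * real N"] e False card by simp
      also have "- 2 * (e * real N)\<^sup>2 / (\<Sum>i\<in>f ` {..<N}. (1 - 0)\<^sup>2) = real N * (- 2 * e\<^sup>2)"
        using False card by (simp add: power2_eq_square)
      also have "exp \<dots> = exp (- 2 * e\<^sup>2) ^ N" by (rule exp_of_nat_mult)
      finally show ?thesis .
    qed
    have "summable (\<lambda>N. prob (A N))"
    proof (rule summable_comparison_test')
      show "summable (\<lambda>N. 2 * exp (- 2 * e\<^sup>2) ^ N)"
        using e by (intro summable_mult summable_geometric) simp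
      show "norm (prob (A N)) \<le> 2 * exp (- 2 * e\<^sup>2) ^ N" if "N \<ge> 0" for N using A by simp
    qed
    then have "AE \<omega> in M. \<forall>\<^sub>F N in sequentially. \<omega> \<in> space M - A N"
      by (intro borel_cantelli_AE1) (auto simp: A_def less_top[symmetric])
    then show ?thesis
    proof eventually_elim
      case (elim \<omega>)
      then show ?case by (rule eventually_mono) (auto simp: A_def not_le)
    qed
  qed
  have "AE \<omega> in M. \<forall>k. \<forall>\<^sub>F N in sequentially.
      \<bar>\<Sum>n<N. Y (f n) \<omega> - expectation (Y (f n))\<bar> < inverse (real (Suc k)) * real N"
    unfolding AE_all_countable by (intro allI ev) simp
  then show ?thesis
  proof eventually_elim
    case (elim \<omega>)
    show ?case
    proof (rule tendstoI)
      fix e :: real assume "e > 0"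
      then obtain k where k: "inverse (real (Suc k)) < e" using reals_Archimedean by blast
      from elim[rule_format, of k] eventually_gt_at_top[of 0]
      show "\<forall>\<^sub>F N in sequentially. dist ((\<Sum>n<N. Y (f n) \<omega> - expectation (Y (f n))) / real N) 0 < e"
      proof eventually_elim
        case (elim N)
        then have "\<bar>\<Sum>n<N. Y (f n) \<omega> - expectation (Y (f n))\<bar> / real N < inverse (real (Suc k))"
          by (simp add: pos_divide_less_eq del: of_nat_Suc)
        then show ?case using k by (simp del: of_nat_Suc)
      qed
    qed
  qed
qed

section \<open>Random digits\<close>

lemma measurable_floor_frac:
  "(\<lambda>x :: real. nat \<lfloor>c * frac (r * x)\<rfloor>) \<in> measurable borel (count_space UNIV)"
  unfolding frac_def by measurable

locale random_digits =
  fixes Q :: "nat \<Rightarrow> nat" and d :: nat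
  assumes Q: "basic_sequence Q" and lim: "infinite_in_limit Q" and d: "d \<le> 1"
begin

text \<open>Position 0 is frozen at 0, as expansions demand.\<close>

definition D :: "nat \<Rightarrow> nat set" where
  "D n = (if n = 0 then {0} else {d..<Q n})"

definition coord :: "nat \<Rightarrow> nat measure" where
  "coord n = measure_pmf (pmf_of_set (D n))"

abbreviation \<Omega> :: "(nat \<Rightarrow> nat) measure" where
  "\<Omega> \<equiv> PiM UNIV coord"

lemma Q2: "n \<ge> 1 \<Longrightarrow> Q n \<ge> 2"
  using Q by (simp add: basic_sequence_def)

lemma D: "finite (D n)" "D n \<noteq> {}" "card (D n) > 0"
proof -
  show "finite (D n)" by (simp add: D_def)
  show "D n \<noteq> {}" using Q2[of n] d by (auto simp: D_def)
  then show "card (D n) > 0" using \<open>finite (D n)\<close> by (simp add: card_gt_0_iff)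
qed

lemma card_D: "n \<ge> 1 \<Longrightarrow> card (D n) = Q n - d"
  by (simp add: D_def)

lemma sets_coord [simp, measurable_cong]: "sets (coord n) = sets (count_space UNIV)"
  by (simp add: coord_def)

lemma space_coord [simp]: "space (coord n) = UNIV"
  by (simp add: coord_def)

lemma measure_coord: "measure (coord n) A = real (card (D n \<inter> A)) / real (card (D n))"
  unfolding coord_def using D by (intro measure_pmf_of_set) auto

sublocale W: prob_space \<Omega>
  by (rule prob_space_PiM) (simp add: coord_def prob_space_measure_pmf)

sublocale P: product_prob_space coord UNIV
  by (rule product_prob_spaceI) (simp add: coord_def prob_space_measure_pmf)

lemma space_\<Omega> [simp]: "space \<Omega> = UNIV"
  by (auto simp: space_PiM)

lemma measurable_digit [measurable]: "(\<lambda>\<omega>. \<omega> n) \<in> measurable \<Omega> (count_space UNIV)"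
  using measurable_component_singleton[of n UNIV coord] by (simp cong: measurable_cong_sets)

lemma sets_digit: "{\<omega> \<in> space \<Omega>. \<omega> n \<in> A} \<in> sets \<Omega>"
  by (rule sets_Collect_single') auto

lemma indep_digits: "W.indep_vars coord (\<lambda>n \<omega>. \<omega> n) UNIV"
proof (subst W.indep_vars_iff_distr_eq_PiM)
  show "distr \<Omega> \<Omega> (\<lambda>x. \<lambda>i\<in>UNIV. x i) = Pi\<^sub>M UNIV (\<lambda>i. distr \<Omega> (coord i) (\<lambda>\<omega>. \<omega> i))"
    by (simp add: P.PiM_component distr_id2 restrict_UNIV)
qed auto

lemma prob_digit: "W.prob {\<omega>. \<omega> n \<in> A} = real (card (D n \<inter> A)) / real (card (D n))"
proof -
  have "emeasure \<Omega> {\<omega> \<in> space \<Omega>. \<omega> n \<in> A} = emeasure (coord n) A"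
    by (rule P.emeasure_PiM_Collect_single) auto
  then show ?thesis by (simp add: measure_coord[symmetric] measure_def)
qed

lemma AE_digits_in_D: "AE \<omega> in \<Omega>. \<forall>n. \<omega> n \<in> D n"
  unfolding AE_all_countable
proof
  fix n
  have "AE k in coord n. k \<in> D n"
    unfolding coord_def by (simp add: AE_measure_pmf_iff D)
  then show "AE \<omega> in \<Omega>. \<omega> n \<in> D n" by (intro P.AE_component) auto
qed

text \<open>The probability is the quotient of \<open>\<lceil>c * q\<rceil> - d\<close> by
  \<open>q - d\<close>, where \<open>q\<close> is the base; over the common denominator its
  difference from \<open>c\<close> has a bounded numerator.\<close>

lemma prob_digit_less_bound:
  assumes c: "0 < c" "c < 1" and n: "n \<ge> 1"
  shows "\<bar>W.prob {\<omega>. \<omega> n \<in> {k. real k < c * real (Q n)}} - c\<bar> \<le> 2 / (real (Q n) - 1)"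
proof -
  let ?m = "nat \<lceil>c * real (Q n)\<rceil>"
  have q: "real (Q n) \<ge> 2" using Q2[OF n] by simp
  have pos: "0 < c * real (Q n)" using c q by simp
  have "c * real (Q n) \<le> 1 * real (Q n)" using c by (intro mult_right_mono) auto
  then have m: "?m \<le> Q n" by (simp add: ceiling_le_iff)
  \<comment> \<open>Since the ceiling is at least 1, it is at least \<open>d\<close>, and the
    natural subtraction in the count is exact.\<close>
  have "\<lceil>c * real (Q n)\<rceil> \<ge> 1" using pos by linarith
  then have m1: "?m \<ge> 1" and rm: "real ?m = of_int \<lceil>c * real (Q n)\<rceil>" by linarith+
  have "D n \<inter> {k. real k < c * real (Q n)} = {d..<?m}"
  proof -
    have "real k < c * real (Q n) \<longleftrightarrow> k < ?m" for k
      by (simp add: zless_nat_eq_int_zless less_ceiling_iff)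
    then have "{k. real k < c * real (Q n)} = {..<?m}" by (simp add: set_eq_iff)
    moreover have "D n \<inter> {..<?m} = {d..<?m}" using n by (auto simp: D_def intro: less_le_trans[OF _ m])
    ultimately show ?thesis by (simp only:)
  qed
  then have *: "W.prob {\<omega>. \<omega> n \<in> {k. real k < c * real (Q n)}} = (real ?m - real d) / (real (Q n) - real d)"
    using m1 d q n by (simp only: prob_digit card_D) (simp add: of_nat_diff)
  have pos': "real (Q n) - real d > 0" using q d by linarith
  have "(real ?m - real d) / (real (Q n) - real d) - c
      = (real ?m - c * real (Q n) - (1 - c) * real d) / (real (Q n) - real d)"
    using pos' by (simp add: field_simps)
  moreover have "\<bar>real ?m - c * real (Q n) - (1 - c) * real d\<bar> \<le> 2"
  proof -
    have "0 \<le> (1 - c) * real d" using c by simp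
    moreover have "(1 - c) * real d \<le> 1 * 1" using c d by (intro mult_mono) auto
    moreover have "0 \<le> real ?m - c * real (Q n)" "real ?m - c * real (Q n) \<le> 1"
      unfolding rm by linarith+
    ultimately show ?thesis by linarith
  qed
  ultimately have "\<bar>(real ?m - real d) / (real (Q n) - real d) - c\<bar> \<le> 2 / (real (Q n) - real d)"
    using pos' by (simp add: divide_right_mono)
  also have "\<dots> \<le> 2 / (real (Q n) - 1)"
    using q d by (intro divide_left_mono) auto
  finally show ?thesis by (simp only: *)
qed

text \<open>For fixed \<open>t\<close> and \<open>c\<close> the strong law controls the fluctuation
  of the frequency, and its mean tends to \<open>c\<close> because the bases grow. Countably many
  pairs are then combined.\<close>

lemma AE_digits_equidistributed: "AE \<omega> in \<Omega>. digits_equidistributed Q \<omega>"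
proof -
  have "AE \<omega> in \<Omega>. (\<lambda>N. real (card {n. n < N \<and> real (\<omega> (Suc (t * n))) < c * real (Q (Suc (t * n)))}) / real N)
      \<longlonglongrightarrow> c" if t: "t \<ge> 1" and c: "0 < c" "c < 1" for t c
  proof -
    define f where "f n = Suc (t * n)" for n
    define Y where "Y i \<omega> = indicat_real {k. real k < c * real (Q i)} (\<omega> i)" for i and \<omega> :: "nat \<Rightarrow> nat"
    have EY: "W.expectation (Y i) = W.prob {\<omega>. \<omega> i \<in> {k. real k < c * real (Q i)}}" for i
    proof -
      have "Y i = indicator {\<omega>. \<omega> i \<in> {k. real k < c * real (Q i)}}"
        by (auto simp: Y_def fun_eq_iff indicator_def)
      then show ?thesis by simp
    qed
    have slln: "AE \<omega> in \<Omega>. (\<lambda>N. (\<Sum>n<N. Y (f n) \<omega> - W.expectation (Y (f n))) / real N) \<longlonglongrightarrow> 0"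
    proof (rule W.strong_law_bounded)
      show "W.indep_vars (\<lambda>_. borel) Y UNIV"
        unfolding Y_def by (rule W.indep_vars_compose2[OF indep_digits]) (simp cong: measurable_cong_sets)
      show "inj f" using t by (auto simp: f_def inj_def)
    qed (simp add: Y_def indicator_def)
    have mean: "(\<lambda>N. (\<Sum>n<N. W.expectation (Y (f n))) / real N) \<longlonglongrightarrow> c"
    proof (rule cesaro_mean_tendsto)
      have "strict_mono f" using t by (auto simp: f_def strict_mono_def)
      then have "filterlim (\<lambda>n. Q (f n)) at_top sequentially"
        using lim unfolding infinite_in_limit_def by (blast intro: filterlim_compose filterlim_subseq)
      then have "filterlim (\<lambda>n. real (Q (f n))) at_top sequentially"
        by (rule filterlim_compose[OF filterlim_real_sequentially])
      then have "filterlim (\<lambda>n. - 1 + real (Q (f n))) at_top sequentially"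
        by (rule filterlim_tendsto_add_at_top[OF tendsto_const])
      then have "(\<lambda>n. 2 / (real (Q (f n)) - 1)) \<longlonglongrightarrow> 0"
        using real_tendsto_divide_at_top[OF tendsto_const[of 2]] by fastforce
      moreover have "\<forall>\<^sub>F n in sequentially. norm (W.expectation (Y (f n)) - c) \<le> 2 / (real (Q (f n)) - 1)"
        using prob_digit_less_bound[OF c] by (intro always_eventually) (auto simp: EY f_def)
      ultimately have "(\<lambda>n. W.expectation (Y (f n)) - c) \<longlonglongrightarrow> 0"
        by (rule Lim_null_comparison[rotated])
      then show "(\<lambda>n. W.expectation (Y (f n))) \<longlonglongrightarrow> c" by (rule LIM_zero_cancel)
    qed
    from slln show ?thesis
    proof eventually_elim
      case (elim \<omega>)
      have "real (card {n. n < N \<and> real (\<omega> (Suc (t * n))) < c * real (Q (Suc (t * n)))}) = (\<Sum>n<N. Y (f n) \<omega>)" for N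
      proof -
        have "(\<Sum>n<N. Y (f n) \<omega>) = (\<Sum>n<N. if n \<in> {n. real (\<omega> (f n)) < c * real (Q (f n))} then 1 else 0)"
          by (intro sum.cong) (auto simp: Y_def)
        also have "\<dots> = real (card ({..<N} \<inter> {n. real (\<omega> (f n)) < c * real (Q (f n))}))"
          by (subst sum.inter_restrict[symmetric]) auto
        finally show ?thesis by (simp add: f_def Int_def)
      qed
      then show ?case
        using tendsto_add[OF elim mean] by (simp add: sum_subtractf diff_divide_distrib)
    qed
  qed
  then have "AE \<omega> in \<Omega>. \<forall>t. \<forall>c\<in>\<rat>. t \<ge> 1 \<and> 0 < c \<and> c < 1 \<longrightarrow>
      (\<lambda>N. real (card {n. n < N \<and> real (\<omega> (Suc (t * n))) < c * real (Q (Suc (t * n)))}) / real N) \<longlonglongrightarrow> c"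
    unfolding AE_all_countable AE_ball_countable[OF countable_rat] by (auto intro: AE_I2)
  then show ?thesis
    by eventually_elim (auto simp: digits_equidistributed_def)
qed

text \<open>Equidistribution supplies the infinitely many non-maximal digits.\<close>

lemma AE_admissible: "AE \<omega> in \<Omega>. admissible_digits Q \<omega>"
  using AE_digits_in_D AE_digits_equidistributed
proof eventually_elim
  case (elim \<omega>)
  have "\<omega> 0 = 0" using elim(1)[rule_format, of 0] by (simp add: D_def)
  moreover have "\<omega> n < Q n" if "n \<ge> 1" for n
    using elim(1)[rule_format, of n] that by (simp add: D_def)
  ultimately show ?case
    using digits_equidistributed_infinite[OF Q elim(2)] by (simp add: admissible_digits_def)
qed

lemma measurable_cantor_value [measurable]: "cantor_value Q \<in> borel_measurable \<Omega>"
  unfolding cantor_value_def[abs_def] by measurable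

lemma sets_cantor_value: "S \<in> sets borel \<Longrightarrow> {\<omega>. cantor_value Q \<omega> \<in> S} \<in> sets \<Omega>"
  using measurable_sets[OF measurable_cantor_value, of S] by (simp add: vimage_def)

lemma AE_cantor_value: "AE \<omega> in \<Omega>. cantor_value Q \<omega> \<in> {0..<1}"
  using AE_admissible
  by eventually_elim (use cantor_value_bounds(1,2)[OF Q, of _ 0] in auto)

section \<open>Mass of intervals under the random value\<close>

text \<open>A prefix value fixes \<open>n\<close> digits, hence has probability at most the
  reciprocal of the product; the interval meets at most \<open>(b - a) * cantor_base Q n + 2\<close>
  prefix values.\<close>

lemma interval_mass:
  assumes ab: "a \<le> b"
  shows "W.prob {\<omega>. cantor_value Q \<omega> \<in> {a..b}}
      \<le> ((b - a) * real (cantor_base Q n) + 2) / (\<Prod>i=1..n. real (card (D i)))"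
proof -
  let ?P = "real (cantor_base Q n)" and ?p = "\<Prod>i=1..n. real (card (D i))"
  define K where "K = {\<lfloor>a * ?P\<rfloor>..\<lfloor>b * ?P\<rfloor>}"
  have p: "?p > 0" using D by (intro prod_pos) auto
  \<comment> \<open>Each prefix event is enclosed in a measurable cylinder; a prefix value that no
    sequence attains gets the empty set.\<close>
  have "\<exists>B. B \<in> sets \<Omega> \<and> W.prob B \<le> 1 / ?p \<and>
      {\<omega>. (\<forall>n. \<omega> n \<in> D n) \<and> int (cantor_prefix Q \<omega> n) = k} \<subseteq> B" for k
  proof (cases "{\<omega>. (\<forall>n. \<omega> n \<in> D n) \<and> int (cantor_prefix Q \<omega> n) = k} = {}")
    case True
    then show ?thesis using p by (intro exI[of _ "{}"]) auto
  next
    case False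
    then obtain \<eta> where \<eta>: "\<And>n. \<eta> n \<in> D n" "int (cantor_prefix Q \<eta> n) = k" by auto
    define B where "B = {\<omega> \<in> space \<Omega>. \<forall>i\<in>{1..n}. \<omega> i \<in> {\<eta> i}}"
    have B: "B \<in> sets \<Omega>" unfolding B_def by (intro sets.sets_Collect_finite_All sets_digit) simp
    have "emeasure \<Omega> B = (\<Prod>i=1..n. emeasure (coord i) {\<eta> i})"
      unfolding B_def by (rule P.emeasure_PiM_Collect) auto
    also have "\<dots> = (\<Prod>i=1..n. ennreal (1 / real (card (D i))))"
      using \<eta>(1) by (intro prod.cong) (auto simp: P.M.emeasure_eq_measure measure_coord)
    also have "\<dots> = ennreal (1 / ?p)"
      by (subst prod_ennreal) (auto simp: prod_dividef)
    finally have "W.prob B = 1 / ?p"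
      using p by (simp add: measure_def)
    moreover have "{\<omega>. (\<forall>n. \<omega> n \<in> D n) \<and> int (cantor_prefix Q \<omega> n) = k} \<subseteq> B"
    proof
      fix \<omega> assume "\<omega> \<in> {\<omega>. (\<forall>n. \<omega> n \<in> D n) \<and> int (cantor_prefix Q \<omega> n) = k}"
      then have \<omega>: "\<And>n. \<omega> n \<in> D n" "int (cantor_prefix Q \<omega> n) = k" by auto
      have "\<omega> i < Q i" "\<eta> i < Q i" if "i \<in> {1..n}" for i
        using \<omega>(1)[of i] \<eta>(1)[of i] that by (auto simp: D_def)
      then have "\<omega> i = \<eta> i" if "i \<in> {1..n}" for i
        using that \<omega>(2) \<eta>(2) by (intro cantor_prefix_inj[of Q \<omega> n \<eta> i]) auto
      then show "\<omega> \<in> B" by (auto simp: B_def)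
    qed
    ultimately show ?thesis using B by (intro exI[of _ B]) auto
  qed
  then have "\<exists>B. \<forall>k. B k \<in> sets \<Omega> \<and> W.prob (B k) \<le> 1 / ?p \<and>
      {\<omega>. (\<forall>n. \<omega> n \<in> D n) \<and> int (cantor_prefix Q \<omega> n) = k} \<subseteq> B k"
    by (intro choice allI)
  then obtain B where B [measurable]: "\<And>k. B k \<in> sets \<Omega>" and pB: "\<And>k. W.prob (B k) \<le> 1 / ?p"
    and sub: "\<And>k. {\<omega>. (\<forall>n. \<omega> n \<in> D n) \<and> int (cantor_prefix Q \<omega> n) = k} \<subseteq> B k" by blast
  have "W.prob {\<omega>. cantor_value Q \<omega> \<in> {a..b}} \<le> W.prob (\<Union>k\<in>K. B k)"
  proof (rule W.finite_measure_mono_AE)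
    show "AE \<omega> in \<Omega>. \<omega> \<in> {\<omega>. cantor_value Q \<omega> \<in> {a..b}} \<longrightarrow> \<omega> \<in> (\<Union>k\<in>K. B k)"
      using AE_digits_in_D AE_admissible
    proof eventually_elim
      case (elim \<omega>)
      show ?case
      proof
        assume V: "\<omega> \<in> {\<omega>. cantor_value Q \<omega> \<in> {a..b}}"
        have "int (cantor_prefix Q \<omega> n) = \<lfloor>cantor_value Q \<omega> * ?P\<rfloor>"
          using cantor_value_bounds(1,2)[OF Q elim(2), of n]
          by (intro floor_unique[symmetric]) (auto simp: mult.commute)
        then have "int (cantor_prefix Q \<omega> n) \<in> K"
          using V by (auto simp: K_def intro!: floor_mono mult_right_mono)
        moreover have "\<omega> \<in> B (int (cantor_prefix Q \<omega> n))" using sub elim(1) by blast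
        ultimately show "\<omega> \<in> (\<Union>k\<in>K. B k)" by blast
      qed
    qed
  qed (auto simp: K_def)
  also have "\<dots> \<le> (\<Sum>k\<in>K. W.prob (B k))"
    by (rule W.finite_measure_subadditive_finite) (auto simp: K_def)
  also have "\<dots> \<le> (\<Sum>k\<in>K. 1 / ?p)" by (intro sum_mono pB)
  also have "\<dots> = real (card K) / ?p" by simp
  also have "\<dots> \<le> ((b - a) * ?P + 2) / ?p"
  proof (intro divide_right_mono)
    have "a * ?P \<le> b * ?P" using ab by (intro mult_right_mono) auto
    then have "\<lfloor>a * ?P\<rfloor> \<le> \<lfloor>b * ?P\<rfloor>" by (rule floor_mono)
    then have "real (card K) = of_int (\<lfloor>b * ?P\<rfloor> + 1 - \<lfloor>a * ?P\<rfloor>)"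
      by (simp add: K_def)
    also have "\<dots> \<le> b * ?P - a * ?P + 2" by linarith
    finally show "real (card K) \<le> (b - a) * ?P + 2" by (simp add: algebra_simps)
  qed (use p in auto)
  finally show ?thesis .
qed

text \<open>Excluding the digit 0 concentrates mass by a factor of at most 2 per level. As the bases
  grow, \<open>Q i powr (1 - s)\<close> eventually absorbs this factor, which accounts for the
  passage from exponent 1 to \<open>s\<close>.\<close>

lemma interval_mass_powr:
  assumes s: "0 < s" "s < 1"
  obtains C where "C \<ge> 0"
    "\<And>a b. a < b \<Longrightarrow> b - a \<le> 1 \<Longrightarrow> W.prob {\<omega>. cantor_value Q \<omega> \<in> {a..b}} \<le> C * (b - a) powr s"
proof -
  let ?P = "\<lambda>n. real (cantor_base Q n)" and ?p = "\<lambda>n. \<Prod>i=1..n. real (card (D i))"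
  define g where "g i = real (Q i) / real (card (D i))" for i
  \<comment> \<open>\<open>h i\<close> compares the concentration factor \<open>g i\<close> with its
    allowance; it is eventually at most 1, so the products \<open>H n\<close> stay bounded.\<close>
  define h where "h i = g i / real (Q i) powr (1 - s)" for i
  have card: "real (card (D i)) = real (Q i) - real d" if "i \<ge> 1" for i
    using card_D[OF that] Q2[OF that] d by (simp add: of_nat_diff)
  have g: "0 < g i" "g i \<le> 2" if "i \<ge> 1" for i
  proof -
    have "real (Q i) \<ge> 2" using Q2[OF that] by simp
    then show "0 < g i" "g i \<le> 2"
      using d by (auto simp: g_def card[OF that] field_simps)
  qed
  have h: "0 < h i" if "i \<ge> 1" for i
    using g[OF that] Q2[OF that] by (simp add: h_def)
  have "filterlim (\<lambda>n. real (Q n)) at_top sequentially"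
    using lim unfolding infinite_in_limit_def by (rule filterlim_compose[OF filterlim_real_sequentially])
  then have "filterlim (\<lambda>n. real (Q n) powr (1 - s)) at_top sequentially"
    using s by (intro filterlim_compose[OF real_powr_at_top]) auto
  then have "\<forall>\<^sub>F n in sequentially. 2 \<le> real (Q n) powr (1 - s)"
    by (simp add: filterlim_at_top)
  then obtain m where m: "\<And>n. n \<ge> m \<Longrightarrow> 2 \<le> real (Q n) powr (1 - s)"
    unfolding eventually_sequentially by blast
  have h1: "h n \<le> 1" if "n \<ge> m" "n \<ge> 1" for n
    using g(2)[OF that(2)] m[OF that(1)] Q2[OF that(2)] by (simp add: h_def divide_le_eq_1)
  define H where "H n = (\<Prod>i=1..n. h i)" for n
  have H0: "H n > 0" for n unfolding H_def by (intro prod_pos) (auto intro: h)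
  have Hdec: "H (Suc n) \<le> H n" if "n \<ge> m" for n
    using h1[of "Suc n"] that H0[of n] by (simp add: H_def mult_left_le)
  \<comment> \<open>From \<open>m\<close> on the products do not increase, so the sum of the first
    ones, all positive, bounds every one.\<close>
  define C where "C = (\<Sum>n\<le>m. H n)"
  have C0: "C > 0" unfolding C_def using H0 by (intro sum_pos) auto
  have HC: "H n \<le> C" for n
  proof (induction n)
    case 0
    show ?case unfolding C_def using H0 by (intro member_le_sum) (auto intro: less_imp_le)
  next
    case (Suc n)
    show ?case
    proof (cases "Suc n \<le> m")
      case True
      then show ?thesis unfolding C_def using H0 by (intro member_le_sum) (auto intro: less_imp_le)
    next
      case False
      then show ?thesis using Hdec[of n] Suc by simp
    qed
  qed
  have ratio: "?P n / ?p n \<le> C * ?P n powr (1 - s)" for n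
  proof -
    have P: "?P n = (\<Prod>i=1..n. real (Q i))" by (simp add: cantor_base_def)
    have "?P n / ?p n = (\<Prod>i=1..n. g i)" by (simp add: P g_def prod_dividef)
    also have "\<dots> = (\<Prod>i=1..n. h i * real (Q i) powr (1 - s))"
      by (intro prod.cong) (auto simp: h_def g_def)
    also have "\<dots> = H n * ?P n powr (1 - s)"
      by (simp add: prod.distrib H_def P prod_powr_distrib)
    also have "\<dots> \<le> C * ?P n powr (1 - s)" by (intro mult_right_mono HC) auto
    finally show ?thesis .
  qed
  show thesis
  proof (rule that)
    show "0 \<le> 6 * C" using C0 by simp
    fix a b :: real assume ab: "a < b" "b - a \<le> 1"
    define r where "r = b - a"
    have r: "0 < r" "r \<le> 1" using ab by (auto simp: r_def)
    have "\<exists>n. 1 / r < ?P n"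
    proof -
      obtain n where "1 / r < 2 ^ n" using real_arch_pow[of 2 "1 / r"] by auto
      also have "2 ^ n \<le> ?P n"
        using cantor_base_ge[OF Q, of n] by (metis of_nat_le_iff of_nat_numeral of_nat_power)
      finally show ?thesis by blast
    qed
    \<comment> \<open>The level is matched to the scale:
      \<open>?P n \<le> 1 / r < ?P (Suc n)\<close>. The least index is positive because
      \<open>r \<le> 1\<close>.\<close>
    then have L: "1 / r < ?P (LEAST n. 1 / r < ?P n)" by (rule LeastI_ex)
    moreover have "\<not> 1 / r < ?P 0" using r by (simp add: field_simps)
    ultimately obtain n where n: "(LEAST n. 1 / r < ?P n) = Suc n"
      by (metis not0_implies_Suc)
    have Pn: "?P n \<le> 1 / r" using not_less_Least[of n "\<lambda>n. 1 / r < ?P n"] n by simp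
    have PS: "1 \<le> r * ?P (Suc n)" using L n r by (simp add: field_simps)
    have p: "?p n > 0" for n using D by (intro prod_pos) auto
    have "W.prob {\<omega>. cantor_value Q \<omega> \<in> {a..b}} \<le> (r * ?P (Suc n) + 2) / ?p (Suc n)"
      unfolding r_def using ab by (intro interval_mass) auto
    \<comment> \<open>\<open>PS\<close> absorbs the summand 2; the resulting 3 and the bound 2 on
      \<open>g\<close> make up the constant 6.\<close>
    also have "\<dots> \<le> (3 * (r * ?P (Suc n))) / ?p (Suc n)"
      using PS p[of "Suc n", THEN less_imp_le] by (intro divide_right_mono) linarith+
    also have "\<dots> = 3 * r * (?P n / ?p n) * g (Suc n)"
      by (simp add: g_def field_simps)
    also have "\<dots> \<le> 3 * r * (?P n / ?p n) * 2"
      using r p[of n] g[of "Suc n"] by (intro mult_left_mono) (auto intro: less_imp_le)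
    also have "\<dots> \<le> 3 * r * (C * ?P n powr (1 - s)) * 2"
      using r ratio[of n] by (intro mult_left_mono mult_right_mono) auto
    also have "\<dots> \<le> 3 * r * (C * (1 / r) powr (1 - s)) * 2"
      using r C0 s Pn by (intro mult_left_mono mult_right_mono powr_mono2) auto
    also have "\<dots> = 6 * C * (r powr 1 * (1 / r) powr (1 - s))" using r by simp
    also have "r powr 1 * (1 / r) powr (1 - s) = r powr s"
      using r by (simp add: powr_divide powr_diff)
    finally show "W.prob {\<omega>. cantor_value Q \<omega> \<in> {a..b}} \<le> 6 * C * (b - a) powr s"
      by (simp add: r_def)
  qed
qed

lemma hausdorff_dim_if_AE:
  assumes "AE \<omega> in \<Omega>. cantor_value Q \<omega> \<in> A"
  shows "hausdorff_dim A = 1"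
proof (rule hausdorff_dim_real_eq_1I)
  fix s :: real assume s: "0 < s" "s < 1"
  then obtain C where "C \<ge> 0"
    "\<And>a b. a < b \<Longrightarrow> b - a \<le> 1 \<Longrightarrow> W.prob {\<omega>. cantor_value Q \<omega> \<in> {a..b}} \<le> C * (b - a) powr s"
    using interval_mass_powr by blast
  then show "hausdorff_measure s A \<noteq> 0"
    using s assms by (intro W.mass_distribution_principle[of "cantor_value Q" A s C]) auto
qed

end

section \<open>Lebesgue measure as the law of uniform random digits\<close>

abbreviation unit_lebesgue :: "real measure" where
  "unit_lebesgue \<equiv> uniform_measure lborel {0..1}"

lemma prob_space_unit_lebesgue: "prob_space unit_lebesgue"
  by (intro prob_space_uniform_measure) auto

locale uniform_digits = random_digits Q 0 for Q
begin

text \<open>With all digits allowed the product of the digit counts is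
  \<open>cantor_base Q n\<close>, so the interval bound exceeds the length by a term vanishing as
  \<open>n\<close> grows.\<close>

lemma interval_mass_le:
  assumes "a \<le> b"
  shows "W.prob {\<omega>. cantor_value Q \<omega> \<in> {a..b}} \<le> b - a"
proof (rule LIMSEQ_le_const)
  have P: "real (cantor_base Q n) > 0" for n using cantor_base_pos[OF Q] by simp
  have "(\<lambda>n. b - a + 2 * (1 / real (cantor_base Q n))) \<longlonglongrightarrow> b - a + 2 * 0"
    by (intro tendsto_intros tendsto_inverse_cantor_base Q)
  then show "(\<lambda>n. b - a + 2 * (1 / real (cantor_base Q n))) \<longlonglongrightarrow> b - a" by simp
  have "(\<Prod>i=1..n. real (card (D i))) = real (cantor_base Q n)" for n
    by (simp add: cantor_base_def card_D)
  then have "W.prob {\<omega>. cantor_value Q \<omega> \<in> {a..b}} \<le> b - a + 2 * (1 / real (cantor_base Q n))" for n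
    using interval_mass[OF assms, of n] P[of n] by (simp add: add_divide_distrib)
  then show "\<exists>N. \<forall>n\<ge>N. W.prob {\<omega>. cantor_value Q \<omega> \<in> {a..b}} \<le> b - a + 2 * (1 / real (cantor_base Q n))"
    by blast
qed

text \<open>Masses of intervals are at most their lengths; applied to \<open>{0..x}\<close> and
  \<open>{x..1}\<close>, which together carry mass 1, this forces equality.\<close>

lemma distr_cantor_value: "distr \<Omega> borel (cantor_value Q) = unit_lebesgue"
proof (rule cdf_unique)
  interpret U: prob_space unit_lebesgue by (rule prob_space_unit_lebesgue)
  show "real_distribution (distr \<Omega> borel (cantor_value Q))" by (rule W.real_distribution_distr) measurable
  show "real_distribution unit_lebesgue" by unfold_locales simp
  show "cdf (distr \<Omega> borel (cantor_value Q)) = cdf unit_lebesgue"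
  proof
    fix x :: real
    have X: "cdf (distr \<Omega> borel (cantor_value Q)) x = W.prob {\<omega>. cantor_value Q \<omega> \<le> x}"
      by (simp add: cdf_def measure_distr vimage_def)
    have U: "cdf unit_lebesgue x = measure lborel ({0..1} \<inter> {..x})"
      by (simp add: cdf_def measure_uniform_measure)
    have sets: "{\<omega>. cantor_value Q \<omega> \<le> x} \<in> W.events"
      using sets_cantor_value[of "{..x}"] by simp
    consider "x < 0" | "0 \<le> x" "x \<le> 1" | "x > 1" by linarith
    then show "cdf (distr \<Omega> borel (cantor_value Q)) x = cdf unit_lebesgue x"
    proof cases
      case 1
      then have "{0..1} \<inter> {..x} = {}" by auto
      moreover have "AE \<omega> in \<Omega>. \<not> cantor_value Q \<omega> \<le> x"
        using AE_cantor_value by eventually_elim (use 1 in auto)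
      then have "W.prob {\<omega> \<in> space \<Omega>. cantor_value Q \<omega> \<le> x} = 0"
        by (subst W.prob_eq_0) (auto simp: sets)
      ultimately show ?thesis by (simp add: X U)
    next
      case 3
      then have "{0..1} \<inter> {..x} = {0..1}" by auto
      moreover have "AE \<omega> in \<Omega>. cantor_value Q \<omega> \<le> x"
        using AE_cantor_value by eventually_elim (use 3 in auto)
      then have "W.prob {\<omega> \<in> space \<Omega>. cantor_value Q \<omega> \<le> x} = 1"
        by (subst W.prob_eq_1) (auto simp: sets)
      ultimately show ?thesis by (simp add: X U)
    next
      case 2
      then have "{0..1} \<inter> {..x} = {0..x}" by auto
      then have "cdf unit_lebesgue x = x" using 2 by (simp add: U)
      moreover have "W.prob {\<omega>. cantor_value Q \<omega> \<le> x} = x"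
      proof (rule antisym)
        have "W.prob {\<omega>. cantor_value Q \<omega> \<le> x} \<le> W.prob {\<omega>. cantor_value Q \<omega> \<in> {0..x}}"
        proof (rule W.finite_measure_mono_AE)
          show "AE \<omega> in \<Omega>. \<omega> \<in> {\<omega>. cantor_value Q \<omega> \<le> x} \<longrightarrow> \<omega> \<in> {\<omega>. cantor_value Q \<omega> \<in> {0..x}}"
            using AE_cantor_value by eventually_elim auto
        qed (rule sets_cantor_value, simp)
        also have "\<dots> \<le> x - 0" using 2 by (intro interval_mass_le)
        finally show "W.prob {\<omega>. cantor_value Q \<omega> \<le> x} \<le> x" by simp
        have "W.prob {\<omega>. \<not> cantor_value Q \<omega> \<le> x} \<le> W.prob {\<omega>. cantor_value Q \<omega> \<in> {x..1}}"
        proof (rule W.finite_measure_mono_AE)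
          show "AE \<omega> in \<Omega>. \<omega> \<in> {\<omega>. \<not> cantor_value Q \<omega> \<le> x} \<longrightarrow> \<omega> \<in> {\<omega>. cantor_value Q \<omega> \<in> {x..1}}"
            using AE_cantor_value by eventually_elim auto
        qed (rule sets_cantor_value, simp)
        also have "\<dots> \<le> 1 - x" using 2 by (intro interval_mass_le)
        finally show "x \<le> W.prob {\<omega>. cantor_value Q \<omega> \<le> x}"
          using W.prob_neg[of "\<lambda>\<omega>. cantor_value Q \<omega> \<le> x"] sets by simp
      qed
      ultimately show ?thesis by (simp add: X)
    qed
  qed
qed

lemma measurable_cantor_digits: "cantor_digits Q \<in> measurable borel \<Omega>"
proof (rule measurable_PiM_single')
  fix n
  show "(\<lambda>x. cantor_digits Q x n) \<in> measurable borel (coord n)"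
  proof (cases n)
    case 0
    then have "(\<lambda>x. cantor_digits Q x n) = (\<lambda>_. 0)"
      using admissible_cantor_digits(1)[OF Q] by (auto simp: admissible_digits_def)
    then show ?thesis by simp
  next
    case (Suc m)
    have "(\<lambda>x. cantor_digits Q x n) \<in> measurable borel (count_space UNIV)"
      unfolding Suc cantor_digits_Suc[OF Q] cantor_shift_def by (rule measurable_floor_frac)
    then show ?thesis by (simp cong: measurable_cong_sets)
  qed
qed auto

text \<open>\<open>cantor_digits Q\<close> inverts \<open>cantor_value Q\<close> almost surely, so
  it carries Lebesgue measure back to \<open>\<Omega>\<close>. Statements about different bases
  thereby move to one common space.\<close>

lemma AE_unit_lebesgue_cantor_digits:
  assumes "AE \<omega> in \<Omega>. P \<omega>"
  shows "AE x in unit_lebesgue. P (cantor_digits Q x)"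
proof (rule AE_distrD[where P = P and M' = \<Omega> and f = "cantor_digits Q"])
  show "cantor_digits Q \<in> measurable unit_lebesgue \<Omega>"
    using measurable_cantor_digits by (simp cong: measurable_cong_sets)
  have "distr unit_lebesgue \<Omega> (cantor_digits Q) = distr \<Omega> \<Omega> (cantor_digits Q \<circ> cantor_value Q)"
    unfolding distr_cantor_value[symmetric]
    by (rule distr_distr[OF measurable_cantor_digits]) measurable
  also have "\<dots> = distr \<Omega> \<Omega> (\<lambda>\<omega>. \<omega>)"
  proof (rule distr_cong_AE)
    show "AE \<omega> in \<Omega>. (cantor_digits Q \<circ> cantor_value Q) \<omega> = \<omega>"
      using AE_admissible by eventually_elim (simp add: cantor_digits_cantor_value[OF Q])
    show "cantor_digits Q \<circ> cantor_value Q \<in> measurable \<Omega> \<Omega>"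
      using measurable_cantor_value measurable_cantor_digits by (rule measurable_comp)
  qed auto
  finally have eq: "distr unit_lebesgue \<Omega> (cantor_digits Q) = \<Omega>" by (simp add: distr_id2)
  show "AE \<omega> in distr unit_lebesgue \<Omega> (cantor_digits Q). P \<omega>"
    unfolding eq by (rule assms)
qed

text \<open>A zero at position \<open>n\<close> has probability \<open>1 / Q n\<close>;
  1-convergence makes these summable, and Borel-Cantelli applies.\<close>

lemma AE_finite_zeros:
  assumes "one_convergent Q"
  shows "AE \<omega> in \<Omega>. finite {n. n \<ge> 1 \<and> \<omega> n = 0}"
proof -
  define A where "A n = {\<omega>. \<omega> (Suc n) \<in> {0::nat}}" for n
  have A: "W.prob (A n) = 1 / real (Q (Suc n))" for n
  proof -
    have "D (Suc n) \<inter> {0} = {0}" using Q2[of "Suc n"] by (auto simp: D_def)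
    then show ?thesis by (simp only: A_def prob_digit) (simp add: card_D)
  qed
  have "A n \<in> sets \<Omega>" for n
    using sets_digit[of "Suc n" "{0}"] by (simp add: A_def)
  moreover have "summable (\<lambda>n. W.prob (A n))"
    using assms by (simp add: A one_convergent_def one_divergent_def)
  ultimately have "AE \<omega> in \<Omega>. \<forall>\<^sub>F n in sequentially. \<omega> \<in> space \<Omega> - A n"
    by (intro borel_cantelli_AE1) (auto simp: less_top[symmetric])
  then show ?thesis
  proof eventually_elim
    case (elim \<omega>)
    then obtain m where m: "\<And>n. n \<ge> m \<Longrightarrow> \<omega> (Suc n) \<noteq> 0"
      unfolding eventually_sequentially by (auto simp: A_def)
    have "{n. n \<ge> 1 \<and> \<omega> n = 0} \<subseteq> {..m}"
    proof
      fix n assume n: "n \<in> {n. n \<ge> 1 \<and> \<omega> n = 0}"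
      then obtain k where "n = Suc k" by (cases n) auto
      then show "n \<in> {..m}" using m[of k] n by (cases "k < m") auto
    qed
    then show ?case by (rule finite_subset) simp
  qed
qed

lemma AE_unit_lebesgue_not_normal:
  assumes "one_convergent Q"
  shows "AE x in unit_lebesgue.
    x \<in> distribution_normal_numbers Q - (ratio_normal_numbers Q \<union> normal_numbers Q)"
  using AE_unit_lebesgue_cantor_digits[OF AE_digits_equidistributed]
    AE_unit_lebesgue_cantor_digits[OF AE_finite_zeros[OF assms]]
proof eventually_elim
  case (elim x)
  show ?case
    using uniformly_distributed_cantor_shift[OF Q lim elim(1), of 1] not_normal_if_finite_zeros[OF elim(2)]
    by (simp add: distribution_normal_numbers_def)
qed

end

text \<open>A length of at most 1 is at most its s-th power, so the mass distribution principle
  applies to the identity with constant 1.\<close>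

lemma hausdorff_dim_if_AE_unit_lebesgue:
  assumes "AE x in unit_lebesgue. x \<in> A"
  shows "hausdorff_dim A = 1"
proof (rule hausdorff_dim_real_eq_1I)
  interpret U: prob_space unit_lebesgue by (rule prob_space_unit_lebesgue)
  fix s :: real assume s: "0 < s" "s < 1"
  show "hausdorff_measure s A \<noteq> 0"
  proof (rule U.mass_distribution_principle[of "\<lambda>x. x" A s 1])
    fix a b :: real assume ab: "a < b" "b - a \<le> 1"
    have "U.prob {a..b} = measure lborel ({0..1} \<inter> {a..b})"
      by (simp add: measure_uniform_measure)
    also have "\<dots> \<le> measure lborel {a..b}"
      by (rule measure_mono_fmeasurable) (auto simp: fmeasurable_def emeasure_lborel_Icc_eq)
    also have "\<dots> = (b - a) powr 1" using ab by simp
    also have "\<dots> \<le> (b - a) powr s" using ab s by (intro powr_mono') auto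
    finally show "U.prob {x \<in> space unit_lebesgue. x \<in> {a..b}} \<le> 1 * (b - a) powr s"
      by (simp del: atLeastAtMost_iff)
  qed (use s assms in auto)
qed

section \<open>Block products\<close>

text \<open>The shifts for \<open>R\<close> are every \<open>t\<close>-th shift for
  \<open>Q\<close>. A zero digit for \<open>R\<close> puts the shift below the reciprocal of the
  base of \<open>R\<close>, hence below that of the first \<open>Q\<close>-base in the block,
  forcing a zero digit for \<open>Q\<close>.\<close>

lemma not_normal_of_coarsening:
  assumes Q: "basic_sequence Q" "infinite_in_limit Q" and R: "basic_sequence R"
    and t: "t \<ge> 1" and base: "\<And>n. cantor_base R n = cantor_base Q (t * n)"
    and E: "digits_equidistributed Q (cantor_digits Q x)"
    and nonzero: "\<And>n. n \<ge> 1 \<Longrightarrow> cantor_digits Q x n \<noteq> 0"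
  shows "x \<in> distribution_normal_numbers R - (ratio_normal_numbers R \<union> normal_numbers R)"
proof -
  have shift: "cantor_shift R n x = cantor_shift Q (t * n) x" for n
    by (simp add: cantor_shift_eq base)
  have "cantor_digits R x (Suc n) \<noteq> 0" for n
  proof
    assume 0: "cantor_digits R x (Suc n) = 0"
    let ?q = "Q (Suc (t * n))" and ?T = "cantor_shift Q (t * n) x"
    have "cantor_base Q (t * n) * ?q \<le> cantor_base Q (t * Suc n)"
      using t cantor_base_mono[OF Q(1), of "Suc (t * n)" "t * Suc n"] by simp
    also have "\<dots> = cantor_base Q (t * n) * R (Suc n)"
      using base[of "Suc n"] base[of n] by simp
    finally have "?q \<le> R (Suc n)" using cantor_base_pos[OF Q(1), of "t * n"] by simp
    have "1 \<le> real (cantor_digits Q x (Suc (t * n)))"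
      using nonzero[of "Suc (t * n)"] by linarith
    also have "\<dots> \<le> real ?q * ?T" by (rule cantor_digits_bounds(1)[OF Q(1)])
    also have "\<dots> \<le> real (R (Suc n)) * ?T"
      using \<open>?q \<le> R (Suc n)\<close> by (intro mult_right_mono) (auto simp: cantor_shift_def)
    also have "\<dots> < 1"
      using cantor_digits_bounds(2)[OF R, of n x] 0 by (simp add: shift)
    finally show False by simp
  qed
  then have "{n. n \<ge> 1 \<and> cantor_digits R x n = 0} = {}"
    by (metis (mono_tags, lifting) Collect_empty_eq One_nat_def Suc_le_D)
  then have "finite {n. n \<ge> 1 \<and> cantor_digits R x n = 0}" by (simp only: finite.emptyI)
  from not_normal_if_finite_zeros[OF this] show ?thesis
    using uniformly_distributed_cantor_shift[OF Q E t]
    by (simp add: distribution_normal_numbers_def shift)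
qed

text \<open>The digits are drawn from \<open>{1..<Q n}\<close>. The almost sure properties concern
  the digits for \<open>Q\<close> alone, so one event serves every \<open>j\<close>.\<close>

lemma hausdorff_dim_coarsenings:
  assumes Q_lim: "basic_sequence Q" "infinite_in_limit Q"
    and R: "\<And>j. j \<in> J \<Longrightarrow> basic_sequence (R j)"
    and t: "\<And>j. j \<in> J \<Longrightarrow> t j \<ge> 1 \<and> (\<forall>n. cantor_base (R j) n = cantor_base Q (t j * n))"
    and A: "(\<Inter>j\<in>J. distribution_normal_numbers (R j) -
      (ratio_normal_numbers (R j) \<union> normal_numbers (R j))) \<subseteq> A"
  shows "hausdorff_dim A = 1"
proof -
  interpret random_digits Q 1 using Q_lim by unfold_locales auto
  show ?thesis
  proof (rule hausdorff_dim_if_AE)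
    show "AE \<omega> in \<Omega>. cantor_value Q \<omega> \<in> A"
      using AE_digits_in_D AE_admissible AE_digits_equidistributed
    proof eventually_elim
      case (elim \<omega>)
      have \<omega>: "cantor_digits Q (cantor_value Q \<omega>) = \<omega>"
        by (rule cantor_digits_cantor_value[OF Q elim(2)])
      have "\<omega> n \<noteq> 0" if "n \<ge> 1" for n
        using elim(1)[rule_format, of n] that unfolding D_def by (simp split: if_splits)
      then have "cantor_value Q \<omega> \<in> distribution_normal_numbers (R j) -
          (ratio_normal_numbers (R j) \<union> normal_numbers (R j))" if "j \<in> J" for j
        using t[OF that] elim(3)
        by (intro not_normal_of_coarsening[OF Q_lim R[OF that], of "t j"]) (auto simp: \<omega>)
      then show ?case using A by blast
    qed
  qed
qed

text \<open>The first \<open>n\<close> blocks of length \<open>s\<close> exhaust the first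
  \<open>s * n\<close> bases of \<open>P\<close>.\<close>

lemma cantor_base_block_product:
  assumes "block_product_related s P Q"
  shows "cantor_base Q n = cantor_base P (s * n)"
proof (induction n)
  case (Suc n)
  have "Q (Suc n) = (\<Prod>j=1..s. P (s * n + j))"
    using assms unfolding block_product_related_def by (metis diff_Suc_1 le_add1 plus_1_eq_Suc)
  also have "\<dots> = (\<Prod>i=s * n + 1..s * n + s. P i)"
    using prod.shift_bounds_cl_nat_ivl[of P 1 "s * n" s] by (simp add: add.commute)
  finally have "cantor_base Q (Suc n) = (\<Prod>i=1..s * n. P i) * (\<Prod>i=s * n + 1..s * n + s. P i)"
    using Suc by (simp add: cantor_base_def)
  also have "\<dots> = (\<Prod>i=1..s * n + s. P i)"
    by (rule prod.ub_add_nat[symmetric]) simp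
  finally show ?case by (simp add: cantor_base_def add.commute)
qed simp

theorem corollary1p4:
  shows "(\<forall>Q :: nat \<Rightarrow> nat \<Rightarrow> nat.
            (\<forall>j\<ge>1. basic_sequence (Q j) \<and> infinite_in_limit (Q j)) \<longrightarrow>
            ((\<forall>j\<ge>1. one_convergent (Q j)) \<or>
             (one_divergent (Q 1) \<and>
              (\<exists>S. basic_sequence S \<and>
                   (\<forall>j\<ge>1. block_product_related (S j) (Q j) (Q (Suc j)))))) \<longrightarrow>
            hausdorff_dim (\<Inter>j\<in>{1..}. distribution_normal_numbers (Q j) - ratio_normal_numbers (Q j)) = 1 \<and>
            hausdorff_dim (\<Inter>j\<in>{1..}. distribution_normal_numbers (Q j) - normal_numbers (Q j)) = 1)
       \<and> (\<forall>Q :: nat \<Rightarrow> nat.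
            basic_sequence Q \<and> infinite_in_limit Q \<longrightarrow>
            hausdorff_dim (distribution_normal_numbers Q - ratio_normal_numbers Q) = 1 \<and>
            hausdorff_dim (distribution_normal_numbers Q - normal_numbers Q) = 1)"
proof (rule conjI; intro allI impI)
  fix Q :: "nat \<Rightarrow> nat \<Rightarrow> nat"
  assume Q: "\<forall>j\<ge>1. basic_sequence (Q j) \<and> infinite_in_limit (Q j)"
    and cases: "(\<forall>j\<ge>1. one_convergent (Q j)) \<or>
      (one_divergent (Q 1) \<and>
        (\<exists>S. basic_sequence S \<and> (\<forall>j\<ge>1. block_product_related (S j) (Q j) (Q (Suc j)))))"
  \<comment> \<open>Stated for every superset \<open>A\<close>, this yields both dimension
    formulas.\<close>
  have dim: "hausdorff_dim A = 1"
    if A: "(\<Inter>j\<in>{1..}. distribution_normal_numbers (Q j) -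
      (ratio_normal_numbers (Q j) \<union> normal_numbers (Q j))) \<subseteq> A" for A
    using cases
  proof
    assume conv: "\<forall>j\<ge>1. one_convergent (Q j)"
    \<comment> \<open>One Lebesgue-random number is expanded in every base sequence, so the
      countably many null sets are discarded together.\<close>
    have "AE x in unit_lebesgue. \<forall>j. j \<ge> 1 \<longrightarrow> x \<in> distribution_normal_numbers (Q j) -
        (ratio_normal_numbers (Q j) \<union> normal_numbers (Q j))"
      unfolding AE_all_countable
    proof
      fix j
      show "AE x in unit_lebesgue. j \<ge> 1 \<longrightarrow> x \<in> distribution_normal_numbers (Q j) -
          (ratio_normal_numbers (Q j) \<union> normal_numbers (Q j))"
      proof (cases "j \<ge> 1")
        case True
        then interpret uniform_digits "Q j"
          using Q by unfold_locales auto
        show ?thesis using AE_unit_lebesgue_not_normal conv True by simp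
      qed simp
    qed
    then have "AE x in unit_lebesgue. x \<in> A"
      by (rule eventually_mono) (use A in blast)
    then show ?thesis by (rule hausdorff_dim_if_AE_unit_lebesgue)
  next
    assume "one_divergent (Q 1) \<and>
        (\<exists>S. basic_sequence S \<and> (\<forall>j\<ge>1. block_product_related (S j) (Q j) (Q (Suc j))))"
    then obtain S where S: "basic_sequence S"
      "\<And>j. j \<ge> 1 \<Longrightarrow> block_product_related (S j) (Q j) (Q (Suc j))" by blast
    have S1: "S j \<ge> 1" if "j \<ge> 1" for j
      using S(1) that by (auto simp: basic_sequence_def intro: order_trans[of 1 2])
    \<comment> \<open>Iterating the relation makes each later sequence a coarsening of the first,
      with step the product of the intermediate block lengths.\<close>
    have base: "cantor_base (Q (Suc k)) n = cantor_base (Q 1) ((\<Prod>i=1..k. S i) * n)" for k n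
    proof (induction k arbitrary: n)
      case (Suc k)
      then show ?case
        using cantor_base_block_product[OF S(2)[of "Suc k"], of n] by (simp add: mult.assoc)
    qed simp
    have "(\<Prod>i=1..k. S i) \<ge> 1" for k using S1 by (intro prod_ge_1) auto
    then have t: "(\<Prod>i=1..j - 1. S i) \<ge> 1 \<and>
        (\<forall>n. cantor_base (Q j) n = cantor_base (Q 1) ((\<Prod>i=1..j - 1. S i) * n))" if "j \<in> {1..}" for j
      using base[of "j - 1"] that by simp
    show ?thesis
    proof (rule hausdorff_dim_coarsenings[OF _ _ _ t A])
      show "basic_sequence (Q 1)" "infinite_in_limit (Q 1)" using Q by auto
      show "basic_sequence (Q j)" if "j \<in> {1..}" for j using Q that by auto
    qed
  qed
  show "hausdorff_dim (\<Inter>j\<in>{1..}. distribution_normal_numbers (Q j) - ratio_normal_numbers (Q j)) = 1 \<and>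
      hausdorff_dim (\<Inter>j\<in>{1..}. distribution_normal_numbers (Q j) - normal_numbers (Q j)) = 1"
    by (intro conjI dim) auto
next
  fix Q :: "nat \<Rightarrow> nat" assume Q: "basic_sequence Q \<and> infinite_in_limit Q"
  \<comment> \<open>A single sequence is its own coarsening with step 1, indexed by a one-point
    family.\<close>
  have "hausdorff_dim A = 1"
    if "distribution_normal_numbers Q - (ratio_normal_numbers Q \<union> normal_numbers Q) \<subseteq> A" for A
    using Q that by (intro hausdorff_dim_coarsenings[of Q "{()}" "\<lambda>_. Q" "\<lambda>_. 1"]) auto
  then show "hausdorff_dim (distribution_normal_numbers Q - ratio_normal_numbers Q) = 1 \<and>
      hausdorff_dim (distribution_normal_numbers Q - normal_numbers Q) = 1" by blast
qed

end
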